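(* Let $G=(V,E)$ be a finite simple undirected graph and $v\in V$. Let $H$ be a pattern, $\theta=(H,S)$ an orbit of $H$, $\lambda=(H,i)$ with $i\in S$ a representative of $\theta$, and let $C\subsetneq V(H)$ be a cut set of $H$ with $i\in C$. Then $$\mathrm{M}(v,\lambda)=\sum_{\sigma\in\mathcal{M}(v,(H|_C,i))}\ \prod_{F\in \mathrm{Frag}_C(H)}\deg_F(\sigma)\;-\;\sum_{H'\in \mathrm{Shrink}_C(H)}\ \sum_{\substack{\theta'\in \mathrm{orb}(H'),\\ \lambda'=r(\theta')}}\mathrm{numSh}_C(\lambda,\lambda')\cdot \mathrm{DM}(v,\lambda').$$
   Context: A pattern is a connected simple graph on at least 2 and at most 5 (labeled) vertices. An automorphism of $H$ is a bijection of $V(H)$ preserving edges and non-edges; the orbits of $H$ are the equivalence classes of vertices under "some automorphism maps one to the other". An orbit is written $\theta=(H,S)$ with $S\subseteq V(H)$ the class; $\mathrm{orb}(H)$ is the set of orbits of $H$. A representative of $\theta=(H,S)$ is a pair $(H,i)$ with $i\in S$; $r(\theta)$ is the representative $(H,j)$ with $j$ the smallest-id vertex in $S$. Matches. For any graph $H$, a match of $H$ in $G$ is a bijection $\pi:T\to V(H)$, $T\subseteq V$, such that for $t_1,t_2\in T$, $(\pi(t_1),\pi(t_2))\in E(H)$ implies $(t_1,t_2)\in E$. For $i\in V(H)$, $\mathcal{M}(v,(H,i))$ is the set of all matches $\pi:T\to V(H)$ of $H$ in $G$ with $v\in T$ and $\pi(v)=i$ (different bijections count as different, even if related by an automorphism),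 and $\mathrm{M}(v,(H,i))=|\mathcal{M}(v,(H,i))|$. Two matches of $H$ are equivalent if one is obtained from the other by composing with an automorphism of $H$. For an orbit $\theta'=(H',S')$ and $\lambda'=r(\theta')$, $\mathrm{DM}(v,\lambda')=\mathrm{DM}(v,\theta')$ is the number of inequivalent matches $\pi$ of $H'$ in $G$ whose domain contains $v$ and with $\pi(v)\in S'$. Fragments. $H|_C$ is the subgraph of $H$ induced on $C$ and $H\setminus C$ is the graph left after removing $C$. If $S_1,S_2,\dots$ are the (vertex sets of the) connected components of $H\setminus C$, the fragments are the subgraphs of $H$ induced on $C\cup S_1, C\cup S_2,\dots$; their set is $\mathrm{Frag}_C(H)=\{F_1,F_2,\dots\}$, one for each component. Extensions. If $\sigma:T'\to C$ is a match of $H|_C$ in $G$ and $F$ is a fragment, a match $\pi:T\to V(F)$ of $F$ extends $\sigma$ if $T'\subseteq T$ and $\pi(t)=\sigma(t)$ for all $t\in T'$; $\deg_F(\sigma)$ is the number of matches of $F$ in $G$ that extend $\sigma$. Shrinkages. Let $H'$ be a pattern with $|V(H')|<|V(H)|$. A $C$-shrinkage of $H$ into $H'$ is a collection $\{\tau,\pi_1,\dots,\pi_{|\mathrm{Frag}_C(H)|}\}$ where $\tau:C\to V(H')$ is an injective map sending edges of $H|_C$ to edges of $H'$, each $\pi_\ell:V(F_\ell)\to V(H')$ is an injective map sending edges of $F_\ell$ to edges of $H'$ and agreeing with $\tau$ on $C$, and for every edge $(s,t)\in E(H')$ there are a fragment $F_j$ and an edge $(a,b)$ of $F_j$ with $\pi_j(a)=s$,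 $\pi_j(b)=t$. $\mathrm{Shrink}_C(H)$ is the set of patterns $H'$ (one labeled graph per isomorphism class) for which at least one $C$-shrinkage of $H$ into $H'$ exists. For $\lambda=(H,i)$ and $\lambda'=(H',j)$, $\mathrm{numSh}_C(\lambda,\lambda')$ is the number of distinct $C$-shrinkages of $H$ into $H'$ with $\tau(i)=j$. *)

theory Defs
  imports "Graph_Theory.Digraph_Isomorphism" "HOL-Library.FuncSet"
begin

text \<open>
  Finite simple undirected graphs are the pair graphs of the digraph library
  (locale \<^locale>\<open>pair_graph\<close>): finite, symmetric and loop-free, with every undirected edge
  stored as two opposite arcs. A partial bijection with explicit domain is a map \<open>'a \<rightharpoonup> 'b\<close>,
  so that two matches are equal iff their domains and their values agree.
\<close>

subsection \<open>Patterns and orbits\<close>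

definition pattern :: "'b pair_pre_digraph \<Rightarrow> bool" where
  "pattern H \<longleftrightarrow> pair_graph H \<and> Digraph_Component.connected (with_proj H) \<and>
     2 \<le> card (pverts H) \<and> card (pverts H) \<le> 5"

definition automorphism :: "'b pair_pre_digraph \<Rightarrow> ('b \<Rightarrow> 'b) \<Rightarrow> bool" where
  "automorphism H \<alpha> \<longleftrightarrow> bij_betw \<alpha> (pverts H) (pverts H) \<and>
     (\<forall>x\<in>pverts H. \<forall>y\<in>pverts H. (x, y) \<in> parcs H \<longleftrightarrow> (\<alpha> x, \<alpha> y) \<in> parcs H)"

definition orbit_rel :: "'b pair_pre_digraph \<Rightarrow> 'b rel" where
  "orbit_rel H = {(x, y). x \<in> pverts H \<and> y \<in> pverts H \<and> (\<exists>\<alpha>. automorphism H \<alpha> \<and> \<alpha> x = y)}"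

definition orb :: "'b pair_pre_digraph \<Rightarrow> ('b pair_pre_digraph \<times> 'b set) set" where
  "orb H = Pair H ` (pverts H // orbit_rel H)"

fun orbit_rep :: "'b::linorder pair_pre_digraph \<times> 'b set \<Rightarrow> 'b pair_pre_digraph \<times> 'b" where
  "orbit_rep (H, S) = (H, Min S)"

subsection \<open>Matches\<close>

definition matches :: "'a pair_pre_digraph \<Rightarrow> 'b pair_pre_digraph \<Rightarrow> ('a \<rightharpoonup> 'b) set" where
  "matches G H = {\<pi>. dom \<pi> \<subseteq> pverts G \<and> bij_betw (\<lambda>t. the (\<pi> t)) (dom \<pi>) (pverts H) \<and>
     (\<forall>t\<^sub>1\<in>dom \<pi>. \<forall>t\<^sub>2\<in>dom \<pi>. (the (\<pi> t\<^sub>1), the (\<pi> t\<^sub>2)) \<in> parcs H \<longrightarrow> (t\<^sub>1, t\<^sub>2) \<in> parcs G)}"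

fun matches_at :: "'a pair_pre_digraph \<Rightarrow> 'a \<Rightarrow> 'b pair_pre_digraph \<times> 'b \<Rightarrow> ('a \<rightharpoonup> 'b) set" where
  "matches_at G v (H, i) = {\<pi> \<in> matches G H. \<pi> v = Some i}"

definition M :: "'a pair_pre_digraph \<Rightarrow> 'a \<Rightarrow> 'b pair_pre_digraph \<times> 'b \<Rightarrow> nat" where
  "M G v l = card (matches_at G v l)"

definition match_equiv :: "'a pair_pre_digraph \<Rightarrow> 'b pair_pre_digraph \<Rightarrow> ('a \<rightharpoonup> 'b) rel" where
  "match_equiv G H = {(\<pi>, \<pi>'). \<pi> \<in> matches G H \<and> \<pi>' \<in> matches G H \<and>
     (\<exists>\<alpha>. automorphism H \<alpha> \<and> \<pi>' = map_option \<alpha> \<circ> \<pi>)}"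

fun DM :: "'a pair_pre_digraph \<Rightarrow> 'a \<Rightarrow> 'b pair_pre_digraph \<times> 'b set \<Rightarrow> nat" where
  "DM G v (H, S) =
     card ({\<pi> \<in> matches G H. v \<in> dom \<pi> \<and> the (\<pi> v) \<in> S} // match_equiv G H)"

subsection \<open>Cut sets, fragments and extensions\<close>

definition induced :: "'b pair_pre_digraph \<Rightarrow> 'b set \<Rightarrow> 'b pair_pre_digraph" where
  "induced H C = \<lparr> pverts = C, parcs = {(a, b) \<in> parcs H. a \<in> C \<and> b \<in> C} \<rparr>"

lemma with_proj_induced: "with_proj (induced H C) = with_proj H \<restriction> C"
  by (auto simp: induced_def induce_subgraph_def with_proj_def)

definition remove :: "'b pair_pre_digraph \<Rightarrow> 'b set \<Rightarrow> 'b pair_pre_digraph" where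
  "remove H C = induced H (pverts H - C)"

definition cut_set :: "'b pair_pre_digraph \<Rightarrow> 'b set \<Rightarrow> bool" where
  "cut_set H C \<longleftrightarrow> C \<subset> pverts H \<and> \<not> Digraph_Component.connected (with_proj (remove H C))"

text \<open>
  In a symmetric digraph the strongly connected components are the connected components of the
  undirected graph.
\<close>

definition Frag :: "'b set \<Rightarrow> 'b pair_pre_digraph \<Rightarrow> 'b pair_pre_digraph set" where
  "Frag C H = (\<lambda>S. induced H (C \<union> S)) ` pre_digraph.sccs_verts (with_proj (remove H C))"

definition deg :: "'a pair_pre_digraph \<Rightarrow> 'b pair_pre_digraph \<Rightarrow> ('a \<rightharpoonup> 'b) \<Rightarrow> nat" where
  "deg G F \<sigma> = card {\<pi> \<in> matches G F. \<sigma> \<subseteq>\<^sub>m \<pi>}"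

subsection \<open>Shrinkages\<close>

definition embedding :: "'b pair_pre_digraph \<Rightarrow> 'c pair_pre_digraph \<Rightarrow> ('b \<rightharpoonup> 'c) \<Rightarrow> bool" where
  "embedding K H' f \<longleftrightarrow> dom f = pverts K \<and> ran f \<subseteq> pverts H' \<and> inj_on f (dom f) \<and>
     (\<forall>(a, b)\<in>parcs K. (the (f a), the (f b)) \<in> parcs H')"

text \<open>
  A shrinkage is the pair of \<open>\<tau>\<close> and the family \<open>p\<close> of maps indexed by the fragments; \<open>p\<close> is
  extensional, so that counting shrinkages does not depend on values outside the index set.
\<close>

definition shrinkages :: "'b set \<Rightarrow> 'b pair_pre_digraph \<Rightarrow> 'c pair_pre_digraph \<Rightarrow>
    (('b \<rightharpoonup> 'c) \<times> ('b pair_pre_digraph \<Rightarrow> ('b \<rightharpoonup> 'c))) set" where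
  "shrinkages C H H' = {(\<tau>, p). embedding (induced H C) H' \<tau> \<and>
     p \<in> (\<Pi>\<^sub>E F\<in>Frag C H. {f. embedding F H' f \<and> \<tau> \<subseteq>\<^sub>m f}) \<and>
     (\<forall>(s, t)\<in>parcs H'. \<exists>F\<in>Frag C H. \<exists>(a, b)\<in>parcs F. p F a = Some s \<and> p F b = Some t)}"

fun numSh :: "'b set \<Rightarrow> 'b pair_pre_digraph \<times> 'b \<Rightarrow> 'c pair_pre_digraph \<times> 'c \<Rightarrow> nat" where
  "numSh C (H, i) (H', j) = card {(\<tau>, p) \<in> shrinkages C H H'. \<tau> i = Some j}"

text \<open>
  A system \<open>R\<close> of representatives: one labeled graph per isomorphism class of patterns. Every
  choice is allowed.
\<close>

definition pattern_reps :: "'b pair_pre_digraph set \<Rightarrow> bool" where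
  "pattern_reps R \<longleftrightarrow> (\<forall>P\<in>R. pattern P) \<and>
     (\<forall>P :: 'b pair_pre_digraph. pattern P \<longrightarrow> (\<exists>!P'. P' \<in> R \<and> digraph_iso (with_proj P) (with_proj P')))"

lemma pattern_reps_exist: "\<exists>R :: 'b pair_pre_digraph set. pattern_reps R"
proof -
  let ?I = "\<lambda>(P :: 'b pair_pre_digraph) (Q :: 'b pair_pre_digraph). digraph_iso (with_proj P) (with_proj Q)"
  have wf: "wf_digraph (with_proj P)" if "pattern P" for P :: "'b pair_pre_digraph"
    using that by (simp add: pattern_def wf_digraph_wp_iff pair_graph_def pair_digraph_def
        pair_fin_digraph_def)
  have refl: "?I P P" if "pattern P" for P
    unfolding digraph_iso_def
    by (rule exI[of _ "\<lparr> iso_verts = id, iso_arcs = id, iso_head = snd, iso_tail = fst \<rparr>"])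
      (use wf[OF that] in \<open>auto simp: pre_digraph.digraph_isomorphism_def app_iso_def with_proj_def\<close>)
  have sym: "?I Q P" if "pattern P" "?I P Q" for P Q
    using that digraph_iso_swap wf by blast
  have trans: "?I P T" if "?I P Q" "?I Q T" for P Q T
    using that digraph_iso_trans by blast
  define rep where "rep P = (SOME Q. pattern Q \<and> ?I P Q)" for P
  have rep: "pattern (rep P) \<and> ?I P (rep P)" if "pattern P" for P
    unfolding rep_def by (rule someI[of "\<lambda>Q. pattern Q \<and> ?I P Q" P]) (use that refl in blast)
  have eq: "rep P = rep Q" if "pattern P" "pattern Q" "?I P Q" for P Q
  proof -
    have "(\<lambda>X. pattern X \<and> ?I P X) = (\<lambda>X. pattern X \<and> ?I Q X)"
      using that sym trans by blast
    then show ?thesis unfolding rep_def by simp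
  qed
  have "pattern_reps (rep ` {P. pattern P})"
    unfolding pattern_reps_def
  proof (intro conjI ballI allI impI)
    fix P assume "P \<in> rep ` {P. pattern P}"
    then show "pattern P" using rep by auto
  next
    fix P :: "'b pair_pre_digraph" assume P: "pattern P"
    show "\<exists>!P'. P' \<in> rep ` {P. pattern P} \<and> ?I P P'"
    proof (rule ex1I[of _ "rep P"])
      show "rep P \<in> rep ` {P. pattern P} \<and> ?I P (rep P)" using P rep by blast
    next
      fix X assume X: "X \<in> rep ` {P. pattern P} \<and> ?I P X"
      then obtain Q where Q: "pattern Q" "X = rep Q" by blast
      then have "?I Q P" using X P rep sym trans by metis
      then show "X = rep P" using eq Q P by simp
    qed
  qed
  then show ?thesis by blast
qed

definition Shrink :: "'c pair_pre_digraph set \<Rightarrow> 'b set \<Rightarrow> 'b pair_pre_digraph \<Rightarrow>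
    'c pair_pre_digraph set" where
  "Shrink R C H = {H' \<in> R. card (pverts H') < card (pverts H) \<and> shrinkages C H H' \<noteq> {}}"

end

theory Submission
  imports Defs
begin

text \<open>
  A match of \<open>H|\<^sub>C\<close> together with one extension to each fragment glues to a single map
  \<open>f : V(H) \<rightarrow> V(G)\<close> that is injective on every fragment and preserves edges, so the sum of products
  of degrees counts these maps with \<open>f i = v\<close>. The injective ones are the matches of \<open>H\<close>. A
  non-injective \<open>f\<close> has as image a connected graph with fewer vertices, isomorphic to a unique
  representative \<open>H'\<close>, and it factors as \<open>f = \<pi>\<inverse> \<circ> g\<close> with \<open>\<pi>\<close> a match of \<open>H'\<close> and \<open>g\<close> a shrinkage
  (gluing again turns the shrinkages of \<open>H\<close> into maps \<open>V(H) \<rightarrow> V(H')\<close>). The map \<open>f\<close> determines \<open>\<pi>\<close> up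
  to an automorphism of \<open>H'\<close>. Choosing in the class of \<open>\<pi>\<close> a match that sends \<open>v\<close> to the
  smallest vertex of its orbit makes \<open>g\<close> unique, so each class contributes exactly \<open>numSh\<close> maps.
\<close>

subsection \<open>Graphs, patterns and representatives\<close>

text \<open>Matches point from G to the pattern, but the work is done with their converses, so that
  extension, gluing and composition all take place over the fixed vertex set V(H). One notion, a map
  on V(H) that embeds every fragment, then serves twice: with target G for the products of degrees,
  and with target H' for the shrinkages. Injectivity on fragments keeps the image loop-free: every
  edge of H lies in some fragment, so its two ends are never identified. Only vertices outside C in
  different fragments can be. The edge-covering condition on shrinkages makes the factorization
  rigid. It leaves H' no edges beyond the images of edges of H, so H' is a copy of the image of f
  with exactly these edges, and two factorizations of f differ by an isomorphism; uniqueness of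
  representatives turns it into an automorphism. G may have further edges on the image, which a
  match permits. DM counts classes of matches while numSh fixes one vertex of the orbit. The two fit
  together because equivalent matches admit the same maps f.\<close>

lemma pair_graph_iff:
  "pair_graph G \<longleftrightarrow> finite (pverts G) \<and> parcs G \<subseteq> pverts G \<times> pverts G \<and> sym (parcs G) \<and> irrefl (parcs G)"
proof
  assume "pair_graph G"
  then interpret pair_graph G .
  show "finite (pverts G) \<and> parcs G \<subseteq> pverts G \<times> pverts G \<and> sym (parcs G) \<and> irrefl (parcs G)"
    using pair_finite_verts wellformed' arcs_symmetric no_loops' by (fastforce simp: sym_def irrefl_def)
next
  assume *: "finite (pverts G) \<and> parcs G \<subseteq> pverts G \<times> pverts G \<and> sym (parcs G) \<and> irrefl (parcs G)"
  then have "finite (parcs G)"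
    using finite_subset by blast
  with * show "pair_graph G"
    by unfold_locales (auto simp: symmetric_def irrefl_def)
qed

lemma rtrancl_on_iff:
  assumes "r \<subseteq> A \<times> A" "u \<in> A"
  shows "(u, v) \<in> rtrancl_on A r \<longleftrightarrow> (u, v) \<in> r\<^sup>*"
proof
  show "(u, v) \<in> r\<^sup>* \<Longrightarrow> (u, v) \<in> rtrancl_on A r"
    by (induction rule: rtrancl_induct)
       (use assms in \<open>auto intro: rtrancl_on_into_rtrancl_on\<close>)
qed (rule rtrancl_on_rtranclI)

text \<open>Library connectivity is reachability along the symmetric closure within the vertex set.
  Arcs are already symmetric with ends among the vertices, so plain reachability is the same;
  nonemptiness follows from the lower size bound.\<close>

lemma pattern_iff:
  "pattern H \<longleftrightarrow> pair_graph H \<and> (\<forall>u\<in>pverts H. \<forall>v\<in>pverts H. (u, v) \<in> (parcs H)\<^sup>*) \<and>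
     2 \<le> card (pverts H) \<and> card (pverts H) \<le> 5"
proof -
  have "Digraph_Component.connected (with_proj H) \<longleftrightarrow>
      pverts H \<noteq> {} \<and> (\<forall>u\<in>pverts H. \<forall>v\<in>pverts H. (u, v) \<in> (parcs H)\<^sup>*)"
    if "pair_graph H"
  proof -
    from that have "symcl (parcs H) = parcs H" "parcs H \<subseteq> pverts H \<times> pverts H"
      by (auto simp: pair_graph_iff symcl_def sym_def)
    then show ?thesis
      by (simp add: connected_conv rtrancl_on_iff)
  qed
  then show ?thesis
    by (auto simp: pattern_def)
qed

lemma pattern_graph: "pattern H \<Longrightarrow> pair_graph H"
  by (simp add: pattern_def)

text \<open>Connectedness and a second vertex exclude isolated vertices. This is what lets
  surjectivity on arcs imply surjectivity on vertices later on.\<close>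

lemma pattern_vertex_arc:
  assumes "pattern H" "x \<in> pverts H"
  obtains y where "(x, y) \<in> parcs H"
proof -
  have "\<not> pverts H \<subseteq> {x}"
    using assms(1) card_mono[of "{x}" "pverts H"] by (auto simp: pattern_iff)
  then obtain y where "y \<in> pverts H" "y \<noteq> x" by blast
  with assms have "(x, y) \<in> (parcs H)\<^sup>*" by (auto simp: pattern_iff)
  with \<open>y \<noteq> x\<close> show ?thesis using that by (auto elim: converse_rtranclE)
qed

text \<open>A library isomorphism carries its own arc map and end maps. Between pair graphs the ends
  are \<open>fst\<close> and \<open>snd\<close>, which forces the arc map to act
  coordinatewise.\<close>

lemma digraph_iso_pair:
  assumes "pair_graph P" "pair_graph Q"
  shows "digraph_iso (with_proj P) (with_proj Q) \<longleftrightarrow>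
    (\<exists>f. bij_betw f (pverts P) (pverts Q) \<and>
      (\<forall>x\<in>pverts P. \<forall>y\<in>pverts P. (x, y) \<in> parcs P \<longleftrightarrow> (f x, f y) \<in> parcs Q))"
    (is "_ \<longleftrightarrow> (\<exists>f. ?iso f)")
proof
  assume "digraph_iso (with_proj P) (with_proj Q)"
  then obtain h where h: "pre_digraph.digraph_isomorphism (with_proj P) h"
      and Q: "with_proj Q = app_iso h (with_proj P)"
    by (auto simp: digraph_iso_def)
  have verts: "pverts Q = iso_verts h ` pverts P" and arcs: "parcs Q = iso_arcs h ` parcs P"
    and ends: "iso_tail h = fst" "iso_head h = snd"
    using Q by (simp_all add: with_proj_def app_iso_def)
  have inj: "inj_on (iso_verts h) (pverts P)"
    and arc: "\<And>x y. (x, y) \<in> parcs P \<Longrightarrow> iso_arcs h (x, y) = (iso_verts h x, iso_verts h y)"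
    using h ends by (auto simp: pre_digraph.digraph_isomorphism_def prod_eq_iff)
  have "(x, y) \<in> parcs P \<longleftrightarrow> (iso_verts h x, iso_verts h y) \<in> parcs Q"
    if xy: "x \<in> pverts P" "y \<in> pverts P" for x y
  proof
    assume "(x, y) \<in> parcs P"
    then show "(iso_verts h x, iso_verts h y) \<in> parcs Q"
      using arc arcs by force
  next
    assume "(iso_verts h x, iso_verts h y) \<in> parcs Q"
    then obtain a b where ab: "(a, b) \<in> parcs P" "iso_arcs h (a, b) = (iso_verts h x, iso_verts h y)"
      unfolding arcs by force
    then have "a \<in> pverts P" "b \<in> pverts P"
      using assms(1) by (auto simp: pair_graph_iff)
    with ab arc xy inj have "a = x" "b = y"
      by (auto simp: inj_on_eq_iff)
    with ab show "(x, y) \<in> parcs P"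
      by simp
  qed
  with inj verts have "?iso (iso_verts h)"
    by (auto simp: bij_betw_def)
  then show "\<exists>f. ?iso f"
    by blast
next
  assume "\<exists>f. ?iso f"
  then obtain f where bij: "bij_betw f (pverts P) (pverts Q)"
    and arc: "\<And>x y. x \<in> pverts P \<Longrightarrow> y \<in> pverts P \<Longrightarrow> (x, y) \<in> parcs P \<longleftrightarrow> (f x, f y) \<in> parcs Q"
    by blast
  let ?h = "\<lparr> iso_verts = f, iso_arcs = map_prod f f, iso_head = snd, iso_tail = fst \<rparr>"
  have P: "parcs P \<subseteq> pverts P \<times> pverts P" and Q: "parcs Q \<subseteq> f ` pverts P \<times> f ` pverts P"
    using assms bij by (auto simp: pair_graph_iff bij_betw_def)
  have inj: "inj_on f (pverts P)"
    using bij by (simp add: bij_betw_def)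
  have "wf_digraph (with_proj P)"
    using assms by (simp add: wf_digraph_wp_iff pair_graph_def pair_digraph_def pair_fin_digraph_def)
  moreover have "inj_on (map_prod f f) (parcs P)"
    using map_prod_inj_on[OF inj inj] P by (rule inj_on_subset)
  ultimately have "pre_digraph.digraph_isomorphism (with_proj P) ?h"
    using inj by (simp add: pre_digraph.digraph_isomorphism_def)
  moreover have "parcs Q = map_prod f f ` parcs P"
  proof (intro equalityI subrelI)
    fix s t assume st: "(s, t) \<in> parcs Q"
    then obtain x y where "x \<in> pverts P" "y \<in> pverts P" "s = f x" "t = f y"
      using Q by blast
    then show "(s, t) \<in> map_prod f f ` parcs P"
      using st arc by force
  qed (use P arc in auto)
  ultimately have "pre_digraph.digraph_isomorphism (with_proj P) ?h \<and>
      with_proj Q = app_iso ?h (with_proj P)"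
    using bij by (simp add: with_proj_def app_iso_def bij_betw_def)
  then show "digraph_iso (with_proj P) (with_proj Q)"
    unfolding digraph_iso_def by blast
qed

text \<open>Both \<open>P\<close> and \<open>Q\<close> represent \<open>P\<close> in
  \<open>R\<close>, so uniqueness of the representative identifies them.\<close>

lemma pattern_reps_unique:
  assumes "pattern_reps R" "P \<in> R" "Q \<in> R" "bij_betw f (pverts P) (pverts Q)"
    "\<And>x y. x \<in> pverts P \<Longrightarrow> y \<in> pverts P \<Longrightarrow> (x, y) \<in> parcs P \<longleftrightarrow> (f x, f y) \<in> parcs Q"
  shows "P = Q"
proof -
  have pat: "pattern P" "pattern Q"
    using assms by (auto simp: pattern_reps_def)
  have "digraph_iso (with_proj P) (with_proj P)"
    using pat by (subst digraph_iso_pair) (auto intro: pattern_graph exI[of _ id])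
  moreover have "digraph_iso (with_proj P) (with_proj Q)"
    using pat assms by (subst digraph_iso_pair) (auto intro: pattern_graph)
  moreover have "\<exists>!P'. P' \<in> R \<and> digraph_iso (with_proj P) (with_proj P')"
    using assms pat unfolding pattern_reps_def by blast
  ultimately show ?thesis
    using assms by blast
qed

definition relabel :: "('a \<Rightarrow> 'b) \<Rightarrow> 'a pair_pre_digraph \<Rightarrow> 'b pair_pre_digraph" where
  "relabel h P = \<lparr> pverts = h ` pverts P, parcs = map_prod h h ` parcs P \<rparr>"

lemma relabel_iso:
  assumes "pair_graph P" "inj_on h (pverts P)" "x \<in> pverts P" "y \<in> pverts P"
  shows "(x, y) \<in> parcs P \<longleftrightarrow> (h x, h y) \<in> parcs (relabel h P)"
proof
  assume "(h x, h y) \<in> parcs (relabel h P)"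
  then obtain a b where "(a, b) \<in> parcs P" "h x = h a" "h y = h b"
    by (auto simp: relabel_def)
  moreover from this have "a \<in> pverts P" "b \<in> pverts P"
    using assms by (auto simp: pair_graph_iff)
  ultimately show "(x, y) \<in> parcs P"
    using assms by (simp add: inj_on_eq_iff)
qed (force simp: relabel_def)

lemma pattern_relabel:
  assumes "pattern P" "inj_on h (pverts P)"
  shows "pattern (relabel h P)"
proof -
  have P: "finite (pverts P)" "parcs P \<subseteq> pverts P \<times> pverts P" "sym (parcs P)" "irrefl (parcs P)"
    using assms by (auto simp: pattern_iff pair_graph_iff)
  have "pair_graph (relabel h P)"
    unfolding pair_graph_iff
  proof (intro conjI)
    have "h a \<noteq> h b" if "(a, b) \<in> parcs P" for a b
      using inj_onD[OF assms(2), of a b] that P by (auto simp: irrefl_def)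
    then show "irrefl (parcs (relabel h P))"
      by (auto simp: relabel_def irrefl_def)
    show "sym (parcs (relabel h P))"
      by (rule symI) (use P(3) in \<open>auto simp: relabel_def dest!: symD\<close>)
  qed (use P in \<open>auto simp: relabel_def\<close>)
  moreover have "(h u, h w) \<in> (parcs (relabel h P))\<^sup>*" if "(u, w) \<in> (parcs P)\<^sup>*" for u w
    using that
  proof induction
    case (step y z)
    then have "(h y, h z) \<in> parcs (relabel h P)" by (force simp: relabel_def)
    with step show ?case by simp
  qed simp
  ultimately show ?thesis
    using assms by (auto simp: pattern_iff relabel_def card_image)
qed

text \<open>\<open>R\<close> promises representatives only for patterns on natural numbers, whereas
  \<open>Q\<close> will be an image inside \<open>G\<close>. An injection of its finite vertex set
  first copies it to the right type.\<close>

lemma pattern_reps_obtain: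
  fixes R :: "nat pair_pre_digraph set"
  assumes "pattern_reps R" "pattern Q"
  obtains P f where "P \<in> R" "bij_betw f (pverts Q) (pverts P)"
    "\<And>x y. x \<in> pverts Q \<Longrightarrow> y \<in> pverts Q \<Longrightarrow> (x, y) \<in> parcs Q \<longleftrightarrow> (f x, f y) \<in> parcs P"
proof -
  have fin: "finite (pverts Q)" and graph: "pair_graph Q"
    using assms by (auto simp: pattern_iff pair_graph_iff)
  obtain h :: "_ \<Rightarrow> nat" where h: "inj_on h (pverts Q)"
    using finite_imp_inj_to_nat_seg[OF fin] by blast
  have pat: "pattern (relabel h Q)"
    using assms(2) h by (rule pattern_relabel)
  with assms(1) obtain P where P: "P \<in> R" "digraph_iso (with_proj (relabel h Q)) (with_proj P)"
    unfolding pattern_reps_def by blast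
  moreover have "pattern P"
    using P assms by (auto simp: pattern_reps_def)
  ultimately obtain g where g: "bij_betw g (pverts (relabel h Q)) (pverts P)"
    "\<forall>x\<in>pverts (relabel h Q). \<forall>y\<in>pverts (relabel h Q).
       (x, y) \<in> parcs (relabel h Q) \<longleftrightarrow> (g x, g y) \<in> parcs P"
    using pat by (auto simp: digraph_iso_pair pattern_graph)
  have "bij_betw h (pverts Q) (pverts (relabel h Q))"
    using h by (simp add: bij_betw_def relabel_def)
  then have "bij_betw (g \<circ> h) (pverts Q) (pverts P)"
    using g(1) by (rule bij_betw_trans)
  moreover have "(x, y) \<in> parcs Q \<longleftrightarrow> ((g \<circ> h) x, (g \<circ> h) y) \<in> parcs P"
    if "x \<in> pverts Q" "y \<in> pverts Q" for x y
    using relabel_iso[OF graph h that] g(2) that by (auto simp: relabel_def)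
  ultimately show ?thesis
    using P that by blast
qed

text \<open>Needed because a sum over an infinite index set would be 0. Every member is copied into
  \<open>{..<5}\<close>, 5 being the size bound on patterns. There are finitely many such copies,
  and equal copies come from isomorphic, hence equal, members.\<close>

lemma finite_pattern_reps:
  fixes R :: "'b pair_pre_digraph set"
  assumes "pattern_reps R"
  shows "finite R"
proof -
  have "\<exists>h :: 'b \<Rightarrow> nat. inj_on h (pverts P) \<and> h ` pverts P \<subseteq> {..<5}" if "P \<in> R" for P
  proof -
    have P: "finite (pverts P)" "card (pverts P) \<le> 5"
      using assms that by (auto simp: pattern_reps_def pattern_iff pair_graph_iff)
    then obtain h where "bij_betw h (pverts P) {0..<card (pverts P)}"
      using ex_bij_betw_finite_nat by blast
    with P show ?thesis
      by (intro exI[of _ h]) (auto simp: bij_betw_def)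
  qed
  then obtain h :: "'b pair_pre_digraph \<Rightarrow> 'b \<Rightarrow> nat" where
    h: "\<And>P. P \<in> R \<Longrightarrow> inj_on (h P) (pverts P) \<and> h P ` pverts P \<subseteq> {..<5}"
    by metis
  let ?r = "\<lambda>P. relabel (h P) P"
  \<comment> \<open>A plain pair of sets instead of a record, so that finiteness comes from a
    product of power sets.\<close>
  let ?e = "\<lambda>P :: nat pair_pre_digraph. (pverts P, parcs P)"
  have graph: "pair_graph P" if "P \<in> R" for P
    using assms that by (auto simp: pattern_reps_def pattern_iff)
  have "inj_on (?e \<circ> ?r) R"
  proof (rule inj_onI)
    fix P Q assume PQ: "P \<in> R" "Q \<in> R" "(?e \<circ> ?r) P = (?e \<circ> ?r) Q"
    then have eq: "pverts (?r P) = pverts (?r Q)" "parcs (?r P) = parcs (?r Q)"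
      by auto
    have "bij_betw (h P) (pverts P) (pverts (?r P))" "bij_betw (h Q) (pverts Q) (pverts (?r Q))"
      using h PQ by (auto simp: bij_betw_def relabel_def)
    then have bij: "bij_betw (inv_into (pverts Q) (h Q) \<circ> h P) (pverts P) (pverts Q)"
      using eq bij_betw_inv_into bij_betw_trans by metis
    have "(x, y) \<in> parcs P \<longleftrightarrow>
        ((inv_into (pverts Q) (h Q) \<circ> h P) x, (inv_into (pverts Q) (h Q) \<circ> h P) y) \<in> parcs Q"
      if xy: "x \<in> pverts P" "y \<in> pverts P" for x y
    proof -
      let ?x = "inv_into (pverts Q) (h Q) (h P x)" and ?y = "inv_into (pverts Q) (h Q) (h P y)"
      have "h P x \<in> h Q ` pverts Q" "h P y \<in> h Q ` pverts Q"
        using eq(1) xy by (auto simp: relabel_def)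
      then have "?x \<in> pverts Q" "?y \<in> pverts Q" "h Q ?x = h P x" "h Q ?y = h P y"
        by (auto intro: inv_into_into f_inv_into_f)
      then show ?thesis
        using relabel_iso[OF graph, of P "h P" x y] relabel_iso[OF graph, of Q "h Q" ?x ?y] h PQ xy eq
        by simp
    qed
    with bij show "P = Q"
      using pattern_reps_unique[OF assms] PQ by blast
  qed
  moreover have "(?e \<circ> ?r) ` R \<subseteq> Pow {..<5} \<times> Pow ({..<5} \<times> {..<5})"
    using h graph by (force simp: relabel_def pair_graph_iff)
  then have "finite ((?e \<circ> ?r) ` R)"
    by (rule finite_subset) simp
  ultimately show ?thesis
    by (rule finite_imageD[rotated])
qed

section \<open>Pointwise form of embeddings\<close>

lemma embedding_iff:
  "embedding K G f \<longleftrightarrow> dom f = pverts K \<and> (\<forall>x t. f x = Some t \<longrightarrow> t \<in> pverts G) \<and>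
     (\<forall>x y t. f x = Some t \<longrightarrow> f y = Some t \<longrightarrow> x = y) \<and>
     (\<forall>a b. (a, b) \<in> parcs K \<longrightarrow> (the (f a), the (f b)) \<in> parcs G)"
proof -
  have "ran f \<subseteq> pverts G \<longleftrightarrow> (\<forall>x t. f x = Some t \<longrightarrow> t \<in> pverts G)"
    by (auto simp: ran_def)
  moreover have "inj_on f (dom f) \<longleftrightarrow> (\<forall>x y t. f x = Some t \<longrightarrow> f y = Some t \<longrightarrow> x = y)"
    by (auto simp: inj_on_def dom_def)
  ultimately show ?thesis
    by (auto simp: embedding_def)
qed

lemma embeddingD:
  assumes "embedding K G f"
  shows "dom f = pverts K"
    and "f x = Some t \<Longrightarrow> t \<in> pverts G"
    and "f x = Some t \<Longrightarrow> f y = Some t \<Longrightarrow> x = y"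
    and "(a, b) \<in> parcs K \<Longrightarrow> (the (f a), the (f b)) \<in> parcs G"
proof -
  note * = assms[unfolded embedding_iff]
  show "dom f = pverts K"
    using * by (rule conjunct1)
  show "f x = Some t \<Longrightarrow> t \<in> pverts G"
    by (rule *[THEN conjunct2, THEN conjunct1, rule_format])
  show "f x = Some t \<Longrightarrow> f y = Some t \<Longrightarrow> x = y"
    by (rule *[THEN conjunct2, THEN conjunct2, THEN conjunct1, rule_format])
  show "(a, b) \<in> parcs K \<Longrightarrow> (the (f a), the (f b)) \<in> parcs G"
    by (rule *[THEN conjunct2, THEN conjunct2, THEN conjunct2, rule_format])
qed

lemma embedding_restrict:
  assumes "embedding K G f" "pverts L \<subseteq> pverts K" "parcs L \<subseteq> parcs K \<inter> pverts L \<times> pverts L"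
  shows "embedding L G (f |` pverts L)"
proof -
  have "a \<in> pverts L" "b \<in> pverts L" "(a, b) \<in> parcs K" if "(a, b) \<in> parcs L" for a b
    using assms that by auto
  moreover have "dom (f |` pverts L) = pverts L"
    using assms by (auto simp: embedding_def)
  ultimately show ?thesis
    using assms(1) by (auto simp: embedding_iff restrict_map_def split: if_splits)
qed

subsection \<open>Fragments\<close>

lemma Frag_obtain:
  assumes "F \<in> Frag C H"
  obtains S where "S \<in> pre_digraph.sccs_verts (with_proj (remove H C))" "F = induced H (C \<union> S)"
    "pverts F = C \<union> S"
  using assms by (auto simp: Frag_def induced_def)

text \<open>Injectivity is only local: vertices from different fragments may share a value. These
  are the glued objects, and the target is kept generic because both \<open>G\<close> and the
  smaller patterns occur.\<close>

definition frag_homs :: "'b set \<Rightarrow> 'b pair_pre_digraph \<Rightarrow> 'c pair_pre_digraph \<Rightarrow> ('b \<rightharpoonup> 'c) set" where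
  "frag_homs C H K = {f. dom f = pverts H \<and> (\<forall>F\<in>Frag C H. embedding F K (f |` pverts F))}"

text \<open>The unglued data: shrinkages without the covering condition, and for target
  \<open>G\<close> the converses of a match of the cut part together with one extension per
  fragment.\<close>

definition frag_tuples :: "'b set \<Rightarrow> 'b pair_pre_digraph \<Rightarrow> 'c pair_pre_digraph \<Rightarrow>
    (('b \<rightharpoonup> 'c) \<times> ('b pair_pre_digraph \<Rightarrow> ('b \<rightharpoonup> 'c))) set" where
  "frag_tuples C H K = {(\<tau>, p). embedding (induced H C) K \<tau> \<and>
     p \<in> (\<Pi>\<^sub>E F\<in>Frag C H. {f. embedding F K f \<and> \<tau> \<subseteq>\<^sub>m f})}"

definition frag_split :: "'b set \<Rightarrow> 'b pair_pre_digraph \<Rightarrow> ('b \<rightharpoonup> 'c) \<Rightarrow>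
    ('b \<rightharpoonup> 'c) \<times> ('b pair_pre_digraph \<Rightarrow> ('b \<rightharpoonup> 'c))" where
  "frag_split C H f = (f |` C, \<lambda>F\<in>Frag C H. f |` pverts F)"

context
  fixes H :: "'b pair_pre_digraph" and C :: "'b set"
  assumes graph: "pair_graph H" and proper: "C \<subset> pverts H"
begin

interpretation rest: wf_digraph "with_proj (remove H C)"
  using graph by unfold_locales (auto simp: remove_def induced_def pair_graph_iff)

lemma Frag_verts: "F \<in> Frag C H \<Longrightarrow> C \<subseteq> pverts F \<and> pverts F \<subseteq> pverts H"
proof -
  assume "F \<in> Frag C H"
  then obtain S where S: "S \<in> pre_digraph.sccs_verts (with_proj (remove H C))" "pverts F = C \<union> S"
    by (rule Frag_obtain)
  then have "S \<subseteq> pverts H"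
    using rest.sccs_verts_subsets by (auto simp: remove_def induced_def)
  with S proper show ?thesis by auto
qed

lemma Frag_induced: "F \<in> Frag C H \<Longrightarrow> F = induced H (pverts F)"
  by (erule Frag_obtain) simp

lemma Frag_arcs: "F \<in> Frag C H \<Longrightarrow> (a, b) \<in> parcs F \<longleftrightarrow> (a, b) \<in> parcs H \<and> a \<in> pverts F \<and> b \<in> pverts F"
  using Frag_induced[of F] by (cases F) (auto simp: induced_def)

lemma finite_Frag: "finite (Frag C H)"
proof -
  have "pre_digraph.sccs_verts (with_proj (remove H C)) \<subseteq> Pow (pverts H)"
    using rest.sccs_verts_subsets by (fastforce simp: remove_def induced_def)
  then show ?thesis
    using graph unfolding Frag_def pair_graph_iff by (auto intro: finite_subset)
qed

text \<open>Distinct components are disjoint, so two fragments meet only in \<open>C\<close>. This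
  makes gluing well defined.\<close>

lemma Frag_inter:
  assumes "F \<in> Frag C H" "F' \<in> Frag C H" "x \<in> pverts F" "x \<in> pverts F'" "x \<notin> C"
  shows "F = F'"
proof -
  obtain S S' where "S \<in> pre_digraph.sccs_verts (with_proj (remove H C))" "F = induced H (C \<union> S)"
      "S' \<in> pre_digraph.sccs_verts (with_proj (remove H C))" "F' = induced H (C \<union> S')"
      "x \<in> S" "x \<in> S'"
    using assms by (auto elim!: Frag_obtain)
  then show ?thesis
    using rest.sccs_verts_disjoint[of S S'] by blast
qed

text \<open>The fragment is the one of the component of \<open>a\<close>: a neighbour
  \<open>b\<close> lies either in \<open>C\<close>, which every fragment contains, or in the same
  component. The case \<open>b = a\<close> makes the lemma cover single vertices too.\<close>

lemma Frag_arc_component: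
  assumes "a \<in> pverts H" "a \<notin> C" "b = a \<or> (a, b) \<in> parcs H"
  shows "\<exists>F\<in>Frag C H. a \<in> pverts F \<and> b \<in> pverts F"
proof -
  let ?S = "pre_digraph.scc_of (with_proj (remove H C)) a"
  have a: "a \<in> verts (with_proj (remove H C))"
    using assms by (auto simp: remove_def induced_def)
  have "b \<in> ?S" if "b \<notin> C"
  proof -
    have "b = a \<or> (a, b) \<in> parcs (remove H C) \<and> (b, a) \<in> parcs (remove H C)"
      using assms that graph by (auto simp: remove_def induced_def pair_graph_iff dest: symD)
    then show ?thesis
      using a by (auto simp: rest.scc_of_def)
  qed
  moreover have "a \<in> ?S"
    using a by (rule rest.in_scc_of_self)
  moreover have "induced H (C \<union> ?S) \<in> Frag C H"
    using rest.scc_of_in_sccs_verts[OF a] by (auto simp: Frag_def)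
  moreover have "pverts (induced H (C \<union> ?S)) = C \<union> ?S"
    by (simp add: induced_def)
  ultimately show ?thesis
    by blast
qed

text \<open>A vertex of \<open>C\<close> lies in every fragment, but some fragment must exist;
  properness of \<open>C\<close> supplies a vertex outside and hence its component.\<close>

lemma Frag_vertex_cover:
  assumes "x \<in> pverts H"
  shows "\<exists>F\<in>Frag C H. x \<in> pverts F"
proof (cases "x \<in> C")
  case True
  obtain y where "y \<in> pverts H" "y \<notin> C"
    using proper by blast
  then show ?thesis
    using Frag_arc_component[of y y] Frag_verts True by blast
qed (use Frag_arc_component[of x x] assms in blast)

lemma Frag_arc_cover:
  assumes "(a, b) \<in> parcs H"
  shows "\<exists>F\<in>Frag C H. (a, b) \<in> parcs F"
proof -
  have ab: "a \<in> pverts H" "b \<in> pverts H" "(b, a) \<in> parcs H"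
    using assms graph by (auto simp: pair_graph_iff dest: symD)
  have "\<exists>F\<in>Frag C H. a \<in> pverts F \<and> b \<in> pverts F"
  proof (cases "a \<in> C")
    case True
    then show ?thesis
      using Frag_vertex_cover[OF ab(2)] Frag_verts by blast
  qed (use Frag_arc_component[of a b] assms ab in blast)
  then show ?thesis
    using assms Frag_arcs by blast
qed

subsection \<open>Gluing along the cut set\<close>

text \<open>That the restriction to \<open>C\<close> is an embedding is inherited from any one
  fragment, of which the cut part is a subgraph.\<close>

lemma frag_split_frag_homs:
  assumes "f \<in> frag_homs C H K"
  shows "frag_split C H f \<in> frag_tuples C H K"
proof -
  obtain x where "x \<in> pverts H"
    using proper by blast
  then obtain F where F: "F \<in> Frag C H"
    using Frag_vertex_cover by blast
  then have "embedding F K (f |` pverts F)" "C \<subseteq> pverts F"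
    using assms Frag_verts by (auto simp: frag_homs_def)
  moreover from this have "embedding (induced H C) K (f |` pverts F |` pverts (induced H C))"
    using Frag_arcs[OF F] by (elim embedding_restrict) (auto simp: induced_def)
  ultimately have "embedding (induced H C) K (f |` C)"
    using \<open>C \<subseteq> pverts F\<close> by (simp add: induced_def Int_absorb1)
  moreover have "f |` C \<subseteq>\<^sub>m f |` pverts F" if "F \<in> Frag C H" for F
    using Frag_verts[OF that] by (auto simp: map_le_def restrict_map_def)
  ultimately show ?thesis
    using assms by (auto simp: frag_tuples_def frag_split_def frag_homs_def)
qed

text \<open>Injective because fragments cover the vertices. Surjective because the members of a
  tuple agree with \<open>\<tau>\<close> on \<open>C\<close> and fragments overlap nowhere else, so
  they have a common extension.\<close>

lemma bij_betw_frag_split: "bij_betw (frag_split C H) (frag_homs C H K) (frag_tuples C H K)"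
  unfolding bij_betw_def
proof (intro conjI inj_onI equalityI subsetI)
  fix f g assume fg: "f \<in> frag_homs C H K" "g \<in> frag_homs C H K" "frag_split C H f = frag_split C H g"
  show "f = g"
  proof
    fix x
    show "f x = g x"
    proof (cases "x \<in> pverts H")
      case True
      then obtain F where F: "F \<in> Frag C H" "x \<in> pverts F"
        using Frag_vertex_cover by blast
      with fg(3) have "f |` pverts F = g |` pverts F"
        by (auto simp: frag_split_def dest: fun_cong[of _ _ F])
      with F show ?thesis
        by (metis restrict_in)
    next
      case False
      with fg(1,2) have "x \<notin> dom f" "x \<notin> dom g"
        by (auto simp: frag_homs_def)
      then show ?thesis
        by (simp add: domIff)
    qed
  qed
next
  fix t assume "t \<in> frag_tuples C H K"
  then obtain \<tau> p where t: "t = (\<tau>, p)" "embedding (induced H C) K \<tau>"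
    and p: "p \<in> (\<Pi>\<^sub>E F\<in>Frag C H. {f. embedding F K f \<and> \<tau> \<subseteq>\<^sub>m f})"
    by (auto simp: frag_tuples_def)
  have emb: "embedding F K (p F)" and le: "\<tau> \<subseteq>\<^sub>m p F" if "F \<in> Frag C H" for F
    using p that by (auto simp: PiE_iff)
  have dom: "dom \<tau> = C" "\<And>F. F \<in> Frag C H \<Longrightarrow> dom (p F) = pverts F"
    using t emb by (auto simp: embedding_def induced_def)
  have onC: "p F x = \<tau> x" if "F \<in> Frag C H" "x \<in> C" for F x
    using le[OF that(1)] that dom by (auto simp: map_le_def)
  \<comment> \<open>An arbitrary fragment through \<open>x\<close>; \<open>f_eq\<close> shows that
    the choice does not affect the value.\<close>
  define frag where "frag x = (SOME F. F \<in> Frag C H \<and> x \<in> pverts F)" for x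
  have frag: "frag x \<in> Frag C H \<and> x \<in> pverts (frag x)" if "x \<in> pverts H" for x
    unfolding frag_def by (rule someI_ex) (use Frag_vertex_cover[OF that] in blast)
  define f where "f x = (if x \<in> pverts H then p (frag x) x else None)" for x
  have f_eq: "f x = p F x" if F: "F \<in> Frag C H" "x \<in> pverts F" for F x
  proof -
    have x: "x \<in> pverts H"
      using Frag_verts that by blast
    with F frag[OF x] onC Frag_inter[of F "frag x" x] show ?thesis
      unfolding f_def by (cases "x \<in> C") auto
  qed
  have restr: "f |` pverts F = p F" if "F \<in> Frag C H" for F
  proof
    fix x show "(f |` pverts F) x = p F x"
      using f_eq[OF that] dom(2)[OF that] domIff[of x "p F"] by (cases "x \<in> pverts F") auto
  qed
  have "x \<in> dom f \<longleftrightarrow> x \<in> pverts H" for x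
  proof (cases "x \<in> pverts H")
    case True
    with frag dom(2) have "x \<in> dom (p (frag x))" by blast
    with True show ?thesis by (simp add: f_def domIff)
  qed (simp add: f_def domIff)
  then have "f \<in> frag_homs C H K"
    using emb by (auto simp: frag_homs_def restr)
  moreover have "f |` C = \<tau>"
  proof
    fix x
    show "(f |` C) x = \<tau> x"
    proof (cases "x \<in> C")
      case True
      then have "x \<in> pverts H" using proper by blast
      with frag[OF this] True onC show ?thesis
        by (simp add: f_def)
    qed (use dom in \<open>auto simp: domIff\<close>)
  qed
  moreover have "(\<lambda>F\<in>Frag C H. f |` pverts F) = p"
    by (rule extensionalityI[of _ "Frag C H"]) (use p restr in \<open>auto simp: PiE_iff\<close>)
  ultimately show "t \<in> frag_split C H ` frag_homs C H K"
    using t by (auto simp: frag_split_def)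
next
  fix t assume "t \<in> frag_split C H ` frag_homs C H K"
  then show "t \<in> frag_tuples C H K"
    using frag_split_frag_homs by blast
qed

text \<open>The arc lies inside one fragment, where the map is injective. Hence an arc is never
  collapsed, even by a map that is not injective as a whole.\<close>

lemma frag_homs_arc:
  assumes "f \<in> frag_homs C H K" "(a, b) \<in> parcs H"
  obtains s t where "f a = Some s" "f b = Some t" "(s, t) \<in> parcs K" "s \<noteq> t"
proof -
  obtain F where F: "F \<in> Frag C H" "(a, b) \<in> parcs F"
    using Frag_arc_cover[OF assms(2)] by blast
  then have ab: "a \<in> pverts F" "b \<in> pverts F" "a \<noteq> b"
    using Frag_arcs graph by (auto simp: pair_graph_iff irrefl_def)
  have emb: "embedding F K (f |` pverts F)"
    using assms F by (auto simp: frag_homs_def)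
  with ab have "a \<in> dom (f |` pverts F)" "b \<in> dom (f |` pverts F)"
    by (simp_all add: embedding_def)
  then obtain s t where st: "f a = Some s" "f b = Some t"
    by auto
  moreover from this emb F ab have "(s, t) \<in> parcs K"
    unfolding embedding_def by fastforce
  moreover from st emb ab have "s \<noteq> t"
    unfolding embedding_def inj_on_def by (metis domI restrict_in)
  ultimately show ?thesis
    using that by blast
qed

lemma frag_homs_ran: "f \<in> frag_homs C H K \<Longrightarrow> ran f \<subseteq> pverts K"
proof
  fix s assume f: "f \<in> frag_homs C H K" and "s \<in> ran f"
  then obtain x where x: "f x = Some s"
    by (auto simp: ran_def)
  then obtain F where F: "F \<in> Frag C H" "x \<in> pverts F"
    using f Frag_vertex_cover unfolding frag_homs_def by blast
  with x have "s \<in> ran (f |` pverts F)"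
    by (auto intro!: ranI[of _ x])
  with f F show "s \<in> pverts K"
    by (auto simp: frag_homs_def embedding_def)
qed

lemma finite_frag_homs: "finite (pverts K) \<Longrightarrow> finite (frag_homs C H K)"
  using graph frag_homs_ran
  by (intro finite_subset[OF _ finite_set_of_finite_maps[of "pverts H" "pverts K"]])
     (auto simp: frag_homs_def pair_graph_iff)

lemma embedding_restrict_Frag:
  assumes "embedding H K f" "F \<in> Frag C H"
  shows "embedding F K (f |` pverts F)"
  using assms(1) by (rule embedding_restrict) (use Frag_verts Frag_arcs assms(2) in auto)

lemma embedding_iff_frag_homs: "embedding H K f \<longleftrightarrow> f \<in> frag_homs C H K \<and> inj_on f (dom f)"
proof
  assume f: "f \<in> frag_homs C H K \<and> inj_on f (dom f)"
  moreover have "(the (f a), the (f b)) \<in> parcs K" if "(a, b) \<in> parcs H" for a b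
    using f that by (auto elim!: frag_homs_arc[of f K a b])
  moreover have "ran f \<subseteq> pverts K" "dom f = pverts H"
    using f frag_homs_ran by (auto simp: frag_homs_def)
  ultimately show "embedding H K f"
    by (auto simp: embedding_def)
next
  assume f: "embedding H K f"
  then have "dom f = pverts H" "inj_on f (dom f)"
    unfolding embedding_def by auto
  with embedding_restrict_Frag[OF f] show "f \<in> frag_homs C H K \<and> inj_on f (dom f)"
    by (simp add: frag_homs_def)
qed

end

subsection \<open>Matches as converses of embeddings\<close>

text \<open>Translates between matches and maps out of the pattern. The choice operator is harmless:
  the map is applied to injective \<open>f\<close>, where the preimage is unique.\<close>

definition converse_map :: "('a \<rightharpoonup> 'b) \<Rightarrow> ('b \<rightharpoonup> 'a)" where
  "converse_map f t = (if t \<in> ran f then Some (SOME x. f x = Some t) else None)"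

lemma converse_map_eq_Some:
  assumes "inj_on f (dom f)"
  shows "converse_map f t = Some x \<longleftrightarrow> f x = Some t"
proof
  assume "converse_map f t = Some x"
  then have "\<exists>y. f y = Some t" "x = (SOME x. f x = Some t)"
    by (auto simp: converse_map_def ran_def split: if_splits)
  then show "f x = Some t"
    using someI_ex[of "\<lambda>y. f y = Some t"] by simp
next
  assume x: "f x = Some t"
  then have "(SOME x. f x = Some t) = x"
    using assms by (intro some_equality) (auto simp: inj_on_def dom_def)
  with x show "converse_map f t = Some x"
    by (auto simp: converse_map_def ran_def)
qed

lemma dom_converse_map: "dom (converse_map f) = ran f"
  by (auto simp: converse_map_def split: if_splits)

lemma ran_converse_map: "inj_on f (dom f) \<Longrightarrow> ran (converse_map f) = dom f"
  by (auto simp: ran_def converse_map_eq_Some)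

lemma inj_converse_map: "inj_on f (dom f) \<Longrightarrow> inj_on (converse_map f) (dom (converse_map f))"
  by (rule inj_onI) (metis converse_map_eq_Some domD option.inject)

lemma converse_map_converse_map:
  assumes "inj_on f (dom f)"
  shows "converse_map (converse_map f) = f"
proof
  fix x
  have "converse_map (converse_map f) x = Some t \<longleftrightarrow> f x = Some t" for t
    using assms by (simp add: converse_map_eq_Some inj_converse_map)
  then show "converse_map (converse_map f) x = f x"
    by (metis option.exhaust)
qed

lemma map_le_converse_map:
  assumes "inj_on f (dom f)" "inj_on g (dom g)"
  shows "converse_map f \<subseteq>\<^sub>m converse_map g \<longleftrightarrow> f \<subseteq>\<^sub>m g"
proof -
  have map_le: "h \<subseteq>\<^sub>m k \<longleftrightarrow> (\<forall>x y. h x = Some y \<longrightarrow> k x = Some y)" for h k :: "'x \<rightharpoonup> 'y"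
    by (auto simp: map_le_def dom_def)
  show ?thesis
    unfolding map_le by (auto simp: assms converse_map_eq_Some)
qed

lemma inj_map_the_iff: "inj_on (\<lambda>t. the (f t)) (dom f) \<longleftrightarrow> inj_on f (dom f)"
  by (auto simp: inj_on_def dom_def)

lemma the_image_dom: "(\<lambda>t. the (f t)) ` dom f = ran f"
  by (force simp: ran_def dom_def image_iff)

lemma matches_iff:
  "\<pi> \<in> matches G K \<longleftrightarrow> dom \<pi> \<subseteq> pverts G \<and> inj_on \<pi> (dom \<pi>) \<and> ran \<pi> = pverts K \<and>
    (\<forall>t u x y. \<pi> t = Some x \<longrightarrow> \<pi> u = Some y \<longrightarrow> (x, y) \<in> parcs K \<longrightarrow> (t, u) \<in> parcs G)"
proof -
  have "bij_betw (\<lambda>t. the (\<pi> t)) (dom \<pi>) (pverts K) \<longleftrightarrow> inj_on \<pi> (dom \<pi>) \<and> ran \<pi> = pverts K"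
    by (simp add: bij_betw_def inj_map_the_iff the_image_dom)
  moreover have "(\<forall>t\<in>dom \<pi>. \<forall>u\<in>dom \<pi>. (the (\<pi> t), the (\<pi> u)) \<in> parcs K \<longrightarrow> (t, u) \<in> parcs G) \<longleftrightarrow>
      (\<forall>t u x y. \<pi> t = Some x \<longrightarrow> \<pi> u = Some y \<longrightarrow> (x, y) \<in> parcs K \<longrightarrow> (t, u) \<in> parcs G)"
    by (auto simp: dom_def)
  ultimately show ?thesis
    by (simp add: matches_def)
qed

text \<open>A match only asks that pattern arcs come from arcs of \<open>G\<close>, not the reverse;
  read backwards this is preservation of arcs by an injective map.\<close>

lemma converse_map_in_matches:
  assumes K: "parcs K \<subseteq> pverts K \<times> pverts K" and inj: "inj_on f (dom f)"
  shows "converse_map f \<in> matches G K \<longleftrightarrow> embedding K G f"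
proof -
  have inj': "inj_on (converse_map f) (ran f)"
    using inj_converse_map[OF inj] by (simp add: dom_converse_map)
  have "(\<forall>t u x y. f x = Some t \<longrightarrow> f y = Some u \<longrightarrow> (x, y) \<in> parcs K \<longrightarrow> (t, u) \<in> parcs G) \<longleftrightarrow>
      (\<forall>(a, b)\<in>parcs K. (the (f a), the (f b)) \<in> parcs G)" (is "?L \<longleftrightarrow> ?R") if dom: "dom f = pverts K"
  proof
    assume L: ?L
    show ?R
    proof clarify
      fix a b assume ab: "(a, b) \<in> parcs K"
      then have "a \<in> dom f" "b \<in> dom f"
        using K dom by auto
      with L ab show "(the (f a), the (f b)) \<in> parcs G"
        by auto
    qed
  qed fastforce
  moreover have "ran (converse_map f) = pverts K \<longleftrightarrow> dom f = pverts K"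
    by (simp add: inj ran_converse_map)
  ultimately show ?thesis
    unfolding matches_iff embedding_def converse_map_eq_Some[OF inj] dom_converse_map
    using inj inj' by blast
qed

lemma bij_betw_converse_map:
  assumes "parcs K \<subseteq> pverts K \<times> pverts K"
  shows "bij_betw converse_map {f. embedding K G f} (matches G K)"
proof (rule bij_betw_byWitness[of _ converse_map])
  show "converse_map ` matches G K \<subseteq> {f. embedding K G f}"
  proof clarify
    fix \<pi> assume \<pi>: "\<pi> \<in> matches G K"
    then have inj: "inj_on \<pi> (dom \<pi>)" by (simp add: matches_iff)
    with \<pi> show "embedding K G (converse_map \<pi>)"
      using converse_map_in_matches[OF assms inj_converse_map[OF inj], of G]
      by (simp add: converse_map_converse_map)
  qed
qed (use assms in \<open>auto simp: embedding_def matches_iff converse_map_converse_map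
    intro!: converse_map_in_matches[THEN iffD2]\<close>)

lemma bij_betw_matches_at:
  assumes "parcs K \<subseteq> pverts K \<times> pverts K"
  shows "bij_betw converse_map {f. embedding K G f \<and> f i = Some v} (matches_at G v (K, i))"
proof -
  have "bij_betw converse_map {f \<in> {f. embedding K G f}. f i = Some v} {\<pi> \<in> matches G K. \<pi> v = Some i}"
    by (rule bij_betw_Collect[OF bij_betw_converse_map[OF assms]])
       (auto simp: embedding_def converse_map_eq_Some)
  then show ?thesis by simp
qed

text \<open>Taking converses respects extension of partial maps, so extensions can be counted on the
  pattern side, where all those of one fragment share a domain.\<close>

lemma deg_converse_map:
  assumes "parcs F \<subseteq> pverts F \<times> pverts F" "inj_on \<tau> (dom \<tau>)"
  shows "deg G F (converse_map \<tau>) = card {f. embedding F G f \<and> \<tau> \<subseteq>\<^sub>m f}"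
proof -
  have "bij_betw converse_map {f \<in> {f. embedding F G f}. \<tau> \<subseteq>\<^sub>m f}
      {\<pi> \<in> matches G F. converse_map \<tau> \<subseteq>\<^sub>m \<pi>}"
    by (rule bij_betw_Collect[OF bij_betw_converse_map[OF assms(1)]])
       (use assms(2) in \<open>auto simp: embedding_def map_le_converse_map\<close>)
  then show ?thesis
    by (simp add: deg_def bij_betw_same_card)
qed

lemma finite_embeddings:
  assumes "finite (pverts K)" "finite (pverts G)"
  shows "finite {f. embedding K G f}"
  using finite_set_of_finite_maps[OF assms] by (rule finite_subset[rotated]) (auto simp: embedding_def)

section \<open>Degree products and matches counted as maps on V(H)\<close>

context
  fixes H :: "'b pair_pre_digraph" and C :: "'b set" and i :: 'b
  assumes graph: "pair_graph H" and proper: "C \<subset> pverts H" and i: "i \<in> C"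
begin

text \<open>For fixed \<open>\<tau>\<close> the product of degrees counts independent choices of one
  extension per fragment, a set of dependent functions. Summing over \<open>\<tau>\<close> counts
  tuples, and gluing turns these into maps.\<close>

lemma sum_prod_deg:
  assumes "finite (pverts G)"
  shows "(\<Sum>\<sigma>\<in>matches_at G v (induced H C, i). \<Prod>F\<in>Frag C H. deg G F \<sigma>) =
    card {f \<in> frag_homs C H G. f i = Some v}"
proof -
  have C: "parcs (induced H C) \<subseteq> pverts (induced H C) \<times> pverts (induced H C)"
    by (auto simp: induced_def)
  have F: "parcs F \<subseteq> pverts F \<times> pverts F" "finite (pverts F)" if "F \<in> Frag C H" for F
    using Frag_arcs[OF graph proper that] Frag_verts[OF graph proper that] graph
    by (auto simp: pair_graph_iff intro: finite_subset)
  let ?T = "{\<tau>. embedding (induced H C) G \<tau> \<and> \<tau> i = Some v}"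
  let ?P = "\<lambda>\<tau>. \<Pi>\<^sub>E F\<in>Frag C H. {f. embedding F G f \<and> \<tau> \<subseteq>\<^sub>m f}"
  have finC: "finite (pverts (induced H C))"
    using graph proper by (auto simp: induced_def pair_graph_iff intro: finite_subset)
  have finT: "finite ?T"
    using finite_embeddings[OF finC assms] by (rule finite_subset[rotated]) auto
  have finP: "finite (?P \<tau>)" for \<tau>
    using finite_Frag[OF graph proper] finite_embeddings[OF F(2) assms]
    by (intro finite_PiE) (auto intro: finite_subset[rotated])
  have "(\<Sum>\<sigma>\<in>matches_at G v (induced H C, i). \<Prod>F\<in>Frag C H. deg G F \<sigma>) =
      (\<Sum>\<tau>\<in>?T. \<Prod>F\<in>Frag C H. deg G F (converse_map \<tau>))"
    by (rule sum.reindex_bij_betw[OF bij_betw_matches_at[OF C], symmetric])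
  also have "\<dots> = (\<Sum>\<tau>\<in>?T. card (?P \<tau>))"
    using F finite_Frag[OF graph proper]
    by (intro sum.cong refl) (auto simp: deg_converse_map embedding_def card_PiE intro!: prod.cong)
  also have "\<dots> = card (Sigma ?T ?P)"
    using finT finP by (simp add: card_SigmaI)
  also have "Sigma ?T ?P = {t \<in> frag_tuples C H G. fst t i = Some v}"
    by (auto simp: frag_tuples_def)
  also have "card \<dots> = card {f \<in> frag_homs C H G. f i = Some v}"
    \<comment> \<open>Since \<open>i\<close> lies in \<open>C\<close>, the condition on
      \<open>\<tau> i\<close> is the condition on the glued map at \<open>i\<close>.\<close>
    by (rule bij_betw_same_card[symmetric, OF bij_betw_Collect[OF bij_betw_frag_split[OF graph proper]]])
       (use i in \<open>simp add: frag_split_def\<close>)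
  finally show ?thesis .
qed

lemma M_eq_card_inj_frag_homs:
  "M G v (H, i) = card {f \<in> frag_homs C H G. f i = Some v \<and> inj_on f (dom f)}"
proof -
  have "M G v (H, i) = card {f. embedding H G f \<and> f i = Some v}"
    unfolding M_def
    by (rule bij_betw_same_card[symmetric, OF bij_betw_matches_at])
       (use graph in \<open>simp add: pair_graph_iff\<close>)
  then show ?thesis
    by (simp add: embedding_iff_frag_homs[OF graph proper] conj_ac)
qed

end

subsection \<open>Automorphisms\<close>

lemma automorphism_id: "automorphism K id"
  by (simp add: automorphism_def)

lemma automorphism_mem: "automorphism K \<alpha> \<Longrightarrow> x \<in> pverts K \<Longrightarrow> \<alpha> x \<in> pverts K"
  by (auto simp: automorphism_def bij_betw_def)

lemma automorphism_comp:
  assumes "automorphism K \<alpha>" "automorphism K \<beta>"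
  shows "automorphism K (\<beta> \<circ> \<alpha>)"
  using assms automorphism_mem[OF assms(1)] bij_betw_trans[of \<alpha> _ _ \<beta>]
  unfolding automorphism_def by (metis comp_apply)

lemma automorphism_inv:
  assumes "automorphism K \<alpha>"
  shows "automorphism K (inv_into (pverts K) \<alpha>)"
proof -
  have bij: "bij_betw \<alpha> (pverts K) (pverts K)"
    using assms by (simp add: automorphism_def)
  have "inv_into (pverts K) \<alpha> x \<in> pverts K" "\<alpha> (inv_into (pverts K) \<alpha> x) = x" if "x \<in> pverts K" for x
    using bij_betw_inv_into[OF bij] bij_betw_inv_into_right[OF bij that] that
    by (auto simp: bij_betw_def)
  then show ?thesis
    using assms bij_betw_inv_into[OF bij] unfolding automorphism_def by metis
qed

lemma equiv_orbit_rel: "equiv (pverts K) (orbit_rel K)"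
proof (rule equivI)
  show "sym (orbit_rel K)"
  proof (rule symI)
    fix x y assume "(x, y) \<in> orbit_rel K"
    then obtain \<alpha> where "automorphism K \<alpha>" "\<alpha> x = y" "x \<in> pverts K" "y \<in> pverts K"
      by (auto simp: orbit_rel_def)
    moreover from this have "inv_into (pverts K) \<alpha> y = x"
      by (auto simp: automorphism_def bij_betw_def)
    ultimately show "(y, x) \<in> orbit_rel K"
      using automorphism_inv by (auto simp: orbit_rel_def)
  qed
  show "trans (orbit_rel K)"
  proof (rule transI)
    fix x y z assume "(x, y) \<in> orbit_rel K" "(y, z) \<in> orbit_rel K"
    then obtain \<alpha> \<beta> where "automorphism K \<alpha>" "\<alpha> x = y" "automorphism K \<beta>" "\<beta> y = z"
        "x \<in> pverts K" "z \<in> pverts K"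
      by (auto simp: orbit_rel_def)
    then show "(x, z) \<in> orbit_rel K"
      using automorphism_comp[of K \<alpha> \<beta>] by (auto simp: orbit_rel_def intro!: exI[of _ "\<beta> \<circ> \<alpha>"])
  qed
qed (auto simp: orbit_rel_def refl_on_def intro: automorphism_id[unfolded id_def] exI[of _ id])

lemma matches_automorphism:
  assumes "\<pi> \<in> matches G K" "automorphism K \<alpha>"
  shows "map_option \<alpha> \<circ> \<pi> \<in> matches G K"
proof -
  have \<pi>: "dom \<pi> \<subseteq> pverts G" "inj_on \<pi> (dom \<pi>)" "ran \<pi> = pverts K"
    and arc: "\<And>t u x y. \<pi> t = Some x \<Longrightarrow> \<pi> u = Some y \<Longrightarrow> (x, y) \<in> parcs K \<Longrightarrow> (t, u) \<in> parcs G"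
    using assms(1) unfolding matches_iff by blast+
  have mem: "x \<in> pverts K" if "\<pi> t = Some x" for t x
    using that \<pi>(3) by (auto simp: ran_def)
  have inj: "inj_on \<alpha> (pverts K)" and onto: "\<alpha> ` pverts K = pverts K"
    and \<alpha>: "\<And>x y. x \<in> pverts K \<Longrightarrow> y \<in> pverts K \<Longrightarrow> (x, y) \<in> parcs K \<longleftrightarrow> (\<alpha> x, \<alpha> y) \<in> parcs K"
    using assms(2) by (auto simp: automorphism_def bij_betw_def)
  have "dom (map_option \<alpha> \<circ> \<pi>) = dom \<pi>"
    by (auto simp: dom_def)
  moreover have "inj_on (map_option \<alpha> \<circ> \<pi>) (dom \<pi>)"
  proof (rule inj_onI)
    fix t u assume tu: "t \<in> dom \<pi>" "u \<in> dom \<pi>" "(map_option \<alpha> \<circ> \<pi>) t = (map_option \<alpha> \<circ> \<pi>) u"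
    then have "\<pi> t = \<pi> u"
      using inj mem by (auto simp: inj_on_eq_iff)
    then show "t = u"
      using tu \<pi>(2) by (auto dest: inj_onD)
  qed
  moreover have "ran (map_option \<alpha> \<circ> \<pi>) = \<alpha> ` ran \<pi>"
    by (force simp: ran_def)
  ultimately show ?thesis
    using \<pi> arc \<alpha> onto mem unfolding matches_iff by auto
qed

lemma equiv_match_equiv: "equiv (matches G K) (match_equiv G K)"
proof (rule equivI)
  show "refl_on (matches G K) (match_equiv G K)"
    by (rule refl_onI)
       (auto simp: match_equiv_def fun_eq_iff option.map_id0 intro!: exI[of _ id] automorphism_id)
  show "sym (match_equiv G K)"
  proof (rule symI)
    fix \<pi> \<rho> assume "(\<pi>, \<rho>) \<in> match_equiv G K"
    then obtain \<alpha> where \<alpha>: "automorphism K \<alpha>" "\<rho> = map_option \<alpha> \<circ> \<pi>"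
        and \<pi>: "\<pi> \<in> matches G K" "\<rho> \<in> matches G K"
      by (auto simp: match_equiv_def)
    have "\<pi> t = map_option (inv_into (pverts K) \<alpha>) (\<rho> t)" for t
    proof (cases "\<pi> t")
      case (Some x)
      then have "x \<in> pverts K" using \<pi> by (auto simp: matches_iff intro: ranI)
      with \<alpha> Some show ?thesis by (auto simp: automorphism_def bij_betw_def)
    qed (simp add: \<alpha>)
    then show "(\<rho>, \<pi>) \<in> match_equiv G K"
      using automorphism_inv[OF \<alpha>(1)] \<pi> by (auto simp: match_equiv_def fun_eq_iff)
  qed
  show "trans (match_equiv G K)"
  proof (rule transI)
    fix \<pi> \<rho> \<sigma> assume "(\<pi>, \<rho>) \<in> match_equiv G K" "(\<rho>, \<sigma>) \<in> match_equiv G K"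
    then obtain \<alpha> \<beta> where *: "automorphism K \<alpha>" "\<rho> = map_option \<alpha> \<circ> \<pi>"
        "automorphism K \<beta>" "\<sigma> = map_option \<beta> \<circ> \<rho>" "\<pi> \<in> matches G K" "\<sigma> \<in> matches G K"
      by (auto simp: match_equiv_def)
    then have "\<sigma> = map_option (\<beta> \<circ> \<alpha>) \<circ> \<pi>"
      by (simp add: fun_eq_iff option.map_comp)
    with * automorphism_comp[of K \<alpha> \<beta>] show "(\<pi>, \<sigma>) \<in> match_equiv G K"
      by (auto simp: match_equiv_def)
  qed
qed (auto simp: match_equiv_def)

subsection \<open>Shrinkages as arc-surjective maps\<close>

lemma map_comp_restrict: "(g \<circ>\<^sub>m f) |` A = g \<circ>\<^sub>m (f |` A)"
  by (auto simp: map_comp_def restrict_map_def)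

lemma embedding_comp:
  assumes "embedding F K f" "embedding K G g" "parcs F \<subseteq> pverts F \<times> pverts F"
  shows "embedding F G (g \<circ>\<^sub>m f)"
proof -
  note f = embeddingD[OF assms(1)] and g = embeddingD[OF assms(2)]
  have val: "\<exists>t s. f x = Some t \<and> g t = Some s \<and> (g \<circ>\<^sub>m f) x = Some s" if "x \<in> pverts F" for x
  proof -
    have "x \<in> dom f"
      using that f(1) by simp
    then obtain t where t: "f x = Some t" by auto
    then have "t \<in> dom g"
      using f(2) g(1) by simp
    then obtain s where "g t = Some s" by auto
    with t show ?thesis by simp
  qed
  show ?thesis
    unfolding embedding_iff
  proof (intro conjI allI impI)
    show "dom (g \<circ>\<^sub>m f) = pverts F"
    proof
      show "dom (g \<circ>\<^sub>m f) \<subseteq> pverts F"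
        unfolding f(1)[symmetric] by (auto simp: map_comp_Some_iff)
      show "pverts F \<subseteq> dom (g \<circ>\<^sub>m f)"
        using val by (meson domI subsetI)
    qed
    show "(the ((g \<circ>\<^sub>m f) a), the ((g \<circ>\<^sub>m f) b)) \<in> parcs G" if "(a, b) \<in> parcs F" for a b
    proof -
      have "a \<in> pverts F" "b \<in> pverts F"
        using that assms(3) by auto
      then obtain t s t' s' where "f a = Some t" "g t = Some s" "(g \<circ>\<^sub>m f) a = Some s"
          "f b = Some t'" "g t' = Some s'" "(g \<circ>\<^sub>m f) b = Some s'"
        using val by meson
      with f(4)[OF that] g(4)[of t t'] show ?thesis
        by simp
    qed
    show "t \<in> pverts G" if "(g \<circ>\<^sub>m f) x = Some t" for x t
      using that g(2) by (auto simp: map_comp_Some_iff)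
    show "x = y" if "(g \<circ>\<^sub>m f) x = Some t" "(g \<circ>\<^sub>m f) y = Some t" for x y t
      using that f(3) g(3) unfolding map_comp_Some_iff by metis
  qed
qed

definition arc_onto :: "'b set \<Rightarrow> 'b pair_pre_digraph \<Rightarrow> 'c pair_pre_digraph \<Rightarrow> ('b \<rightharpoonup> 'c) set" where
  "arc_onto C H K = {g \<in> frag_homs C H K.
     \<forall>(s, t)\<in>parcs K. \<exists>(a, b)\<in>parcs H. g a = Some s \<and> g b = Some t}"

text \<open>The maps of the form \<open>\<pi>\<inverse> \<circ> g\<close> with \<open>g\<close> arc-surjective.\<close>

definition factor :: "'b set \<Rightarrow> 'b pair_pre_digraph \<Rightarrow> 'c pair_pre_digraph \<Rightarrow> ('a \<rightharpoonup> 'c) \<Rightarrow>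
    ('b \<rightharpoonup> 'a) set" where
  "factor C H K \<pi> = {f. dom f = pverts H \<and> ran f \<subseteq> dom \<pi> \<and> \<pi> \<circ>\<^sub>m f \<in> arc_onto C H K}"

context
  fixes H :: "'b pair_pre_digraph" and C :: "'b set"
  assumes graph: "pair_graph H" and proper: "C \<subset> pverts H"
begin

lemma Frag_wf: "F \<in> Frag C H \<Longrightarrow> parcs F \<subseteq> pverts F \<times> pverts F"
  using Frag_arcs[OF graph proper] by auto

lemma frag_homs_comp:
  assumes "f \<in> frag_homs C H K" "embedding K G g"
  shows "g \<circ>\<^sub>m f \<in> frag_homs C H G"
proof -
  have "ran f \<subseteq> dom g" "dom f = pverts H"
    using frag_homs_ran[OF graph proper assms(1)] assms by (auto simp: embedding_def frag_homs_def)
  moreover have "x \<in> dom (g \<circ>\<^sub>m f) \<longleftrightarrow> x \<in> dom f" if "ran f \<subseteq> dom g" for x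
  proof (cases "f x")
    case (Some t)
    then show ?thesis
      using that ranI[of f x t] by auto
  qed (simp add: domIff)
  ultimately have "dom (g \<circ>\<^sub>m f) = pverts H"
    by blast
  moreover have "embedding F G ((g \<circ>\<^sub>m f) |` pverts F)" if "F \<in> Frag C H" for F
    unfolding map_comp_restrict
    by (rule embedding_comp[OF _ assms(2) Frag_wf[OF that]])
       (use assms(1) that in \<open>simp add: frag_homs_def\<close>)
  ultimately show ?thesis
    by (simp add: frag_homs_def)
qed

text \<open>Arc preservation gives one direction and covering the other: the arcs of
  \<open>K\<close> are exactly the images of arcs of \<open>H\<close>. Uniqueness of the
  factorization rests on this.\<close>

lemma arc_onto_arc_iff:
  assumes "g \<in> arc_onto C H K"
  shows "(s, t) \<in> parcs K \<longleftrightarrow> (\<exists>a b. (a, b) \<in> parcs H \<and> g a = Some s \<and> g b = Some t)"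
proof
  assume "\<exists>a b. (a, b) \<in> parcs H \<and> g a = Some s \<and> g b = Some t"
  then obtain a b where ab: "(a, b) \<in> parcs H" "g a = Some s" "g b = Some t" by blast
  moreover have "g \<in> frag_homs C H K"
    using assms by (simp add: arc_onto_def)
  ultimately show "(s, t) \<in> parcs K"
    by (auto elim!: frag_homs_arc[OF graph proper])
qed (use assms in \<open>fastforce simp: arc_onto_def\<close>)

text \<open>Gluing again. The covering condition over arcs of fragments becomes one over arcs of
  \<open>H\<close>, because every arc of \<open>H\<close> lies in a fragment.\<close>

lemma shrinkages_bij:
  "bij_betw (frag_split C H) (arc_onto C H K) (shrinkages C H K)"
proof -
  let ?onto = "\<lambda>p. \<forall>(s, t)\<in>parcs K. \<exists>F\<in>Frag C H. \<exists>(a, b)\<in>parcs F. p F a = Some s \<and> p F b = Some t"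
  have "(\<exists>F\<in>Frag C H. \<exists>(a, b)\<in>parcs F.
        (\<lambda>F\<in>Frag C H. g |` pverts F) F a = Some s \<and> (\<lambda>F\<in>Frag C H. g |` pverts F) F b = Some t) \<longleftrightarrow>
      (\<exists>(a, b)\<in>parcs H. g a = Some s \<and> g b = Some t)" (is "?L \<longleftrightarrow> ?R") for g :: "'b \<rightharpoonup> 'c" and s t
  proof
    assume ?L
    then obtain F a b where "F \<in> Frag C H" "(a, b) \<in> parcs F"
        "(g |` pverts F) a = Some s" "(g |` pverts F) b = Some t"
      by auto
    then show ?R
      using Frag_arcs[OF graph proper] by fastforce
  next
    assume ?R
    then obtain a b where ab: "(a, b) \<in> parcs H" "g a = Some s" "g b = Some t"
      by auto
    moreover obtain F where F: "F \<in> Frag C H" "(a, b) \<in> parcs F"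
      using Frag_arc_cover[OF graph proper ab(1)] by blast
    moreover have "a \<in> pverts F" "b \<in> pverts F"
      using Frag_wf F by auto
    ultimately show ?L
      by (intro bexI[of _ F] bexI[of _ "(a, b)"]) auto
  qed
  then have "bij_betw (frag_split C H) {g \<in> frag_homs C H K.
      \<forall>(s, t)\<in>parcs K. \<exists>(a, b)\<in>parcs H. g a = Some s \<and> g b = Some t}
      {t \<in> frag_tuples C H K. ?onto (snd t)}"
    by (intro bij_betw_Collect[OF bij_betw_frag_split[OF graph proper]])
       (unfold frag_split_def snd_conv, intro ball_cong refl, case_tac x, simp only: prod.case)
  moreover have "{t \<in> frag_tuples C H K. ?onto (snd t)} = shrinkages C H K"
    by (auto simp: frag_tuples_def shrinkages_def)
  ultimately show ?thesis
    by (simp add: arc_onto_def)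
qed

lemma numSh_eq_card:
  assumes "i \<in> C"
  shows "numSh C (H, i) (K, j) = card {g \<in> arc_onto C H K. g i = Some j}"
proof -
  have "bij_betw (frag_split C H) {g \<in> arc_onto C H K. g i = Some j}
      {t \<in> shrinkages C H K. fst t i = Some j}"
    by (rule bij_betw_Collect[OF shrinkages_bij]) (use assms in \<open>simp add: frag_split_def\<close>)
  moreover have "{t \<in> shrinkages C H K. fst t i = Some j} = {(\<tau>, p) \<in> shrinkages C H K. \<tau> i = Some j}"
    by auto
  ultimately show ?thesis
    by (simp add: bij_betw_same_card)
qed

lemma arc_onto_automorphism:
  assumes "g \<in> arc_onto C H K" "automorphism K \<alpha>" "parcs K \<subseteq> pverts K \<times> pverts K"
  shows "map_option \<alpha> \<circ> g \<in> arc_onto C H K"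
proof -
  \<comment> \<open>The automorphism as a partial map with domain exactly the vertices of
    \<open>K\<close>, hence an embedding of \<open>K\<close> into itself to which the composition
    lemma applies.\<close>
  let ?a = "\<lambda>x. if x \<in> pverts K then Some (\<alpha> x) else None"
  have bij: "bij_betw \<alpha> (pverts K) (pverts K)"
    and arc: "\<And>x y. x \<in> pverts K \<Longrightarrow> y \<in> pverts K \<Longrightarrow> (x, y) \<in> parcs K \<longleftrightarrow> (\<alpha> x, \<alpha> y) \<in> parcs K"
    using assms(2) by (auto simp: automorphism_def)
  have "dom ?a = pverts K"
    by (auto split: if_splits)
  then have "embedding K K ?a"
    using bij arc assms(3) automorphism_mem[OF assms(2)] unfolding embedding_iff
    by (auto simp: bij_betw_def inj_on_eq_iff split: if_splits)
  moreover have g: "g \<in> frag_homs C H K"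
    using assms(1) by (simp add: arc_onto_def)
  ultimately have "?a \<circ>\<^sub>m g \<in> frag_homs C H K"
    by (intro frag_homs_comp)
  moreover have "?a \<circ>\<^sub>m g = map_option \<alpha> \<circ> g"
    using frag_homs_ran[OF graph proper g]
    by (auto simp: map_comp_def fun_eq_iff ran_def split: option.splits)
  moreover have "\<exists>a b. (a, b) \<in> parcs H \<and> (map_option \<alpha> \<circ> g) a = Some s \<and> (map_option \<alpha> \<circ> g) b = Some t"
    if "(s, t) \<in> parcs K" for s t
  proof -
    have "s \<in> \<alpha> ` pverts K" "t \<in> \<alpha> ` pverts K"
      using that assms(3) bij by (auto simp: bij_betw_def)
    then obtain x y where xy: "x \<in> pverts K" "y \<in> pverts K" "s = \<alpha> x" "t = \<alpha> y"
      by auto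
    then have "(x, y) \<in> parcs K"
      using arc that by blast
    with arc_onto_arc_iff[OF assms(1)] xy show ?thesis
      by fastforce
  qed
  ultimately show ?thesis
    by (fastforce simp: arc_onto_def)
qed

section \<open>Maps that factor through a match\<close>

lemma factor_automorphism:
  assumes "f \<in> factor C H K \<pi>" "automorphism K \<alpha>" "parcs K \<subseteq> pverts K \<times> pverts K"
  shows "f \<in> factor C H K (map_option \<alpha> \<circ> \<pi>)"
proof -
  have "(map_option \<alpha> \<circ> \<pi>) \<circ>\<^sub>m f = map_option \<alpha> \<circ> (\<pi> \<circ>\<^sub>m f)"
    by (auto simp: map_comp_def fun_eq_iff split: option.splits)
  moreover have "dom (map_option \<alpha> \<circ> \<pi>) = dom \<pi>"
    by (auto simp: dom_def)
  ultimately show ?thesis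
    using assms arc_onto_automorphism by (auto simp: factor_def)
qed

lemma converse_map_comp_cancel:
  assumes "inj_on \<pi> (dom \<pi>)"
  shows "ran f \<subseteq> dom \<pi> \<Longrightarrow> converse_map \<pi> \<circ>\<^sub>m (\<pi> \<circ>\<^sub>m f) = f"
    and "ran g \<subseteq> ran \<pi> \<Longrightarrow> \<pi> \<circ>\<^sub>m (converse_map \<pi> \<circ>\<^sub>m g) = g"
proof -
  show "converse_map \<pi> \<circ>\<^sub>m (\<pi> \<circ>\<^sub>m f) = f" if "ran f \<subseteq> dom \<pi>"
  proof
    fix x show "(converse_map \<pi> \<circ>\<^sub>m (\<pi> \<circ>\<^sub>m f)) x = f x"
    proof (cases "f x")
      case (Some t)
      then have "t \<in> dom \<pi>" using that ranI[of f x t] by auto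
      then obtain s where "\<pi> t = Some s" by auto
      with Some show ?thesis by (simp add: converse_map_eq_Some[OF assms])
    qed simp
  qed
  show "\<pi> \<circ>\<^sub>m (converse_map \<pi> \<circ>\<^sub>m g) = g" if "ran g \<subseteq> ran \<pi>"
  proof
    fix x show "(\<pi> \<circ>\<^sub>m (converse_map \<pi> \<circ>\<^sub>m g)) x = g x"
    proof (cases "g x")
      case (Some t)
      then have "t \<in> ran \<pi>" using that ranI[of g x t] by auto
      then obtain s where "\<pi> s = Some t" by (auto simp: ran_def)
      then have "converse_map \<pi> t = Some s" by (simp add: converse_map_eq_Some[OF assms])
      with Some \<open>\<pi> s = Some t\<close> show ?thesis by simp
    qed simp
  qed
qed

lemma factor_frag_homs:
  assumes "f \<in> factor C H K \<pi>" "\<pi> \<in> matches G K" "parcs K \<subseteq> pverts K \<times> pverts K"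
  shows "f \<in> frag_homs C H G"
proof -
  have inj: "inj_on \<pi> (dom \<pi>)"
    using assms(2) by (simp add: matches_iff)
  have "embedding K G (converse_map \<pi>)"
    using converse_map_in_matches[OF assms(3) inj_converse_map[OF inj], of G] assms(2)
    by (simp add: converse_map_converse_map[OF inj])
  moreover have "\<pi> \<circ>\<^sub>m f \<in> frag_homs C H K" "ran f \<subseteq> dom \<pi>"
    using assms(1) by (auto simp: factor_def arc_onto_def)
  ultimately show ?thesis
    using frag_homs_comp converse_map_comp_cancel(1)[OF inj] by metis
qed

text \<open>Each vertex of \<open>K\<close> is an end of some arc, and every arc of \<open>K\<close>
  is hit by \<open>\<pi> \<circ>\<^sub>m f\<close>. As \<open>\<pi>\<close> is injective,
  \<open>f\<close> then reaches all of its domain.\<close>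

lemma factor_ran:
  assumes "f \<in> factor C H K \<pi>" "\<pi> \<in> matches G K" "pattern K"
  shows "ran f = dom \<pi>"
proof
  show "ran f \<subseteq> dom \<pi>"
    using assms(1) by (simp add: factor_def)
  show "dom \<pi> \<subseteq> ran f"
  proof
    fix t assume "t \<in> dom \<pi>"
    then obtain x where x: "\<pi> t = Some x" by blast
    then have "x \<in> pverts K"
      using assms(2) by (auto simp: matches_iff intro: ranI)
    then obtain y where "(x, y) \<in> parcs K"
      using assms(3) pattern_vertex_arc by metis
    then obtain a where "(\<pi> \<circ>\<^sub>m f) a = Some x"
      using assms(1) by (auto simp: factor_def arc_onto_def)
    then obtain u where "f a = Some u" "\<pi> u = Some x"
      by (auto simp: map_comp_Some_iff)
    moreover have "inj_on \<pi> (dom \<pi>)"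
      using assms(2) by (simp add: matches_iff)
    ultimately have "f a = Some t"
      using x by (metis domI inj_onD)
    then show "t \<in> ran f" by (rule ranI)
  qed
qed

text \<open>Composition with the converse of \<open>\<pi>\<close> is the inverse. Fixing the value
  \<open>j\<close> of the match at \<open>v\<close> translates \<open>f i = Some v\<close> into the
  condition counted by \<open>numSh\<close>.\<close>

lemma factor_bij:
  assumes "\<pi> \<in> matches G K" "\<pi> v = Some j"
  shows "bij_betw (\<lambda>f. \<pi> \<circ>\<^sub>m f) {f \<in> factor C H K \<pi>. f i = Some v} {g \<in> arc_onto C H K. g i = Some j}"
proof -
  have inj: "inj_on \<pi> (dom \<pi>)" and ran: "ran \<pi> = pverts K"
    using assms(1) by (simp_all add: matches_iff)
  have g: "ran g \<subseteq> ran \<pi>" "dom g = pverts H" if "g \<in> arc_onto C H K" for g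
    using that frag_homs_ran[OF graph proper, of g K] ran by (auto simp: arc_onto_def frag_homs_def)
  have "converse_map \<pi> \<circ>\<^sub>m g \<in> factor C H K \<pi> \<and> (g i = Some j \<longrightarrow> (converse_map \<pi> \<circ>\<^sub>m g) i = Some v)"
    if "g \<in> arc_onto C H K" for g
  proof -
    have "dom (converse_map \<pi> \<circ>\<^sub>m g) = dom g"
    proof (intro equalityI subsetI)
      fix x assume "x \<in> dom g"
      then obtain t where "g x = Some t" by blast
      moreover from this have "t \<in> dom (converse_map \<pi>)"
        using g(1)[OF that] by (auto simp: dom_converse_map intro: ranI)
      ultimately show "x \<in> dom (converse_map \<pi> \<circ>\<^sub>m g)" by auto
    qed (auto simp: map_comp_Some_iff)
    moreover have "ran (converse_map \<pi> \<circ>\<^sub>m g) \<subseteq> ran (converse_map \<pi>)"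
      by (auto simp: ran_def map_comp_Some_iff)
    ultimately show ?thesis
      using that g converse_map_comp_cancel(2)[OF inj g(1)[OF that]] converse_map_eq_Some[OF inj]
        ran_converse_map[OF inj] assms(2)
      by (auto simp: factor_def)
  qed
  moreover have "converse_map \<pi> \<circ>\<^sub>m (\<pi> \<circ>\<^sub>m f) = f" "\<pi> \<circ>\<^sub>m f \<in> arc_onto C H K" if "f \<in> factor C H K \<pi>" for f
    using that converse_map_comp_cancel(1)[OF inj] by (auto simp: factor_def)
  moreover have "\<pi> \<circ>\<^sub>m (converse_map \<pi> \<circ>\<^sub>m g) = g" if "g \<in> arc_onto C H K" for g
    using that converse_map_comp_cancel(2)[OF inj] g by blast
  ultimately show ?thesis
    using assms(2) by (intro bij_betw_byWitness[of _ "\<lambda>g. converse_map \<pi> \<circ>\<^sub>m g"]) auto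
qed

text \<open>Both matches are bijections from \<open>ran f\<close>, so \<open>\<pi>'\<close> after
  the inverse of \<open>\<pi>\<close> is a bijection. It respects arcs in both directions because in
  either graph they are the images of the arcs of \<open>H\<close> under one and the same
  \<open>f\<close>.\<close>

lemma factor_unique:
  assumes "f \<in> factor C H K \<pi>" "\<pi> \<in> matches G K" "pattern K"
    and "f \<in> factor C H K' \<pi>'" "\<pi>' \<in> matches G K'" "pattern K'"
  obtains \<alpha> where "bij_betw \<alpha> (pverts K) (pverts K')"
    "\<forall>x\<in>pverts K. \<forall>y\<in>pverts K. (x, y) \<in> parcs K \<longleftrightarrow> (\<alpha> x, \<alpha> y) \<in> parcs K'"
    "\<pi>' = map_option \<alpha> \<circ> \<pi>"
proof -
  have inj: "inj_on \<pi> (dom \<pi>)" "inj_on \<pi>' (dom \<pi>')" and ran: "ran \<pi> = pverts K" "ran \<pi>' = pverts K'"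
    using assms by (simp_all add: matches_iff)
  have dom: "dom \<pi> = ran f" "dom \<pi>' = ran f"
    using factor_ran assms by blast+
  have onto: "\<pi> \<circ>\<^sub>m f \<in> arc_onto C H K" "\<pi>' \<circ>\<^sub>m f \<in> arc_onto C H K'"
    using assms by (simp_all add: factor_def)
  define \<alpha> where "\<alpha> x = the (\<pi>' (the (converse_map \<pi> x)))" for x
  have \<alpha>: "\<pi>' t = Some (\<alpha> x)" if "\<pi> t = Some x" for t x
  proof -
    have "converse_map \<pi> x = Some t"
      using that by (simp add: converse_map_eq_Some[OF inj(1)])
    moreover have "t \<in> dom \<pi>'"
      using that dom by blast
    ultimately show ?thesis
      by (auto simp: \<alpha>_def)
  qed
  have pre: "\<exists>t. \<pi> t = Some x" if "x \<in> pverts K" for x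
    using that ran by (auto simp: ran_def)
  have "inj_on \<alpha> (pverts K)"
  proof (rule inj_onI)
    fix x y assume xy: "x \<in> pverts K" "y \<in> pverts K" "\<alpha> x = \<alpha> y"
    then obtain t u where tu: "\<pi> t = Some x" "\<pi> u = Some y"
      using pre by blast
    then have "\<pi>' t = \<pi>' u" "t \<in> dom \<pi>'" "u \<in> dom \<pi>'"
      using \<alpha> xy dom by auto
    then have "t = u"
      using inj(2) by (auto dest: inj_onD)
    with tu show "x = y" by simp
  qed
  moreover have "\<alpha> ` pverts K = pverts K'"
  proof (intro equalityI subsetI)
    fix y assume "y \<in> pverts K'"
    then obtain t where t: "\<pi>' t = Some y"
      unfolding ran(2)[symmetric] by (auto simp: ran_def)
    then obtain x where "\<pi> t = Some x"
      using dom by blast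
    with t \<alpha> show "y \<in> \<alpha> ` pverts K"
      using ran ranI by fastforce
  next
    fix y assume "y \<in> \<alpha> ` pverts K"
    then show "y \<in> pverts K'"
      using pre \<alpha> ran(2) ranI by fastforce
  qed
  ultimately have "bij_betw \<alpha> (pverts K) (pverts K')"
    by (simp add: bij_betw_def)
  moreover have "(x, y) \<in> parcs K \<longleftrightarrow> (\<alpha> x, \<alpha> y) \<in> parcs K'" if xy: "x \<in> pverts K" "y \<in> pverts K" for x y
  proof -
    obtain t u where tu: "\<pi> t = Some x" "\<pi> u = Some y"
      using pre xy by blast
    \<comment> \<open>Removes the match from the composition; afterwards the arc conditions for
      \<open>K\<close> and \<open>K'\<close> are literally the same statement about
      \<open>f\<close>.\<close>
    have *: "(\<rho> \<circ>\<^sub>m f) a = Some z \<longleftrightarrow> f a = Some s"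
      if "inj_on \<rho> (dom \<rho>)" "\<rho> s = Some z" for a s z and \<rho> :: "'a \<rightharpoonup> 'e"
      using that by (auto simp: map_comp_Some_iff dom_def inj_on_def)
    show ?thesis
      unfolding arc_onto_arc_iff[OF onto(1)] arc_onto_arc_iff[OF onto(2)]
        *[OF inj(1) tu(1)] *[OF inj(1) tu(2)] *[OF inj(2) \<alpha>[OF tu(1)]] *[OF inj(2) \<alpha>[OF tu(2)]] ..
  qed
  moreover have "\<pi>' = map_option \<alpha> \<circ> \<pi>"
  proof
    fix t
    show "\<pi>' t = (map_option \<alpha> \<circ> \<pi>) t"
    proof (cases "\<pi> t")
      case None
      then have "t \<notin> dom \<pi>'" using dom by (auto simp: domIff)
      with None show ?thesis by (simp add: domIff)
    qed (simp add: \<alpha>)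
  qed
  ultimately show ?thesis
    using that by blast
qed

end

subsection \<open>The image of a non-injective map\<close>

text \<open>Not the subgraph of \<open>G\<close> induced on the range: only images of arcs of
  \<open>H\<close> are kept, as the covering condition requires.\<close>

definition image_graph :: "'b pair_pre_digraph \<Rightarrow> ('b \<rightharpoonup> 'a) \<Rightarrow> 'a pair_pre_digraph" where
  "image_graph H f = \<lparr> pverts = ran f, parcs = {(s, t). \<exists>a b. (a, b) \<in> parcs H \<and> f a = Some s \<and> f b = Some t} \<rparr>"

lemma the_comp_dom: "dom f = A \<Longrightarrow> (\<lambda>x. the (f x)) ` A = ran f"
  using the_image_dom[of f] by simp

text \<open>Because no arc is collapsed, the image is loop-free and has at least two vertices. Paths
  of \<open>H\<close> are carried along, which gives connectedness, and the bound 5 is inherited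
  since an image is no larger.\<close>

lemma pattern_image_graph:
  assumes H: "pattern H" and proper: "C \<subset> pverts H" and f: "f \<in> frag_homs C H G"
  shows "pattern (image_graph H f)"
proof -
  have graph: "pair_graph H"
    using H by (rule pattern_graph)
  then have fin: "finite (pverts H)" and sym: "sym (parcs H)"
    by (auto simp: pair_graph_iff)
  have dom: "dom f = pverts H"
    using f by (simp add: frag_homs_def)
  have ran: "ran f = (\<lambda>x. the (f x)) ` pverts H"
    using dom by (simp add: the_comp_dom)
  have graph_Q: "pair_graph (image_graph H f)"
    unfolding pair_graph_iff
  proof (intro conjI)
    show "finite (pverts (image_graph H f))"
      using fin by (simp add: image_graph_def ran)
    show "sym (parcs (image_graph H f))"
    proof (rule symI)
      fix s t assume "(s, t) \<in> parcs (image_graph H f)"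
      then obtain a b where "(a, b) \<in> parcs H" "f a = Some s" "f b = Some t"
        by (auto simp: image_graph_def)
      moreover from this have "(b, a) \<in> parcs H"
        using sym by (auto dest: symD)
      ultimately show "(t, s) \<in> parcs (image_graph H f)"
        by (auto simp: image_graph_def)
    qed
    have "f a \<noteq> f b" if "(a, b) \<in> parcs H" for a b
      using frag_homs_arc[OF graph proper f that] by (metis option.inject)
    then show "irrefl (parcs (image_graph H f))"
      by (fastforce simp: image_graph_def irrefl_def)
  qed (auto simp: image_graph_def intro: ranI)
  have "(the (f a), the (f b)) \<in> (parcs (image_graph H f))\<^sup>*" if "(a, b) \<in> (parcs H)\<^sup>*" for a b
    using that
  proof induction
    case (step b c)
    obtain s t where "f b = Some s" "f c = Some t"
      using frag_homs_arc[OF graph proper f step(2)] by blast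
    with step(2) have "(the (f b), the (f c)) \<in> parcs (image_graph H f)"
      by (auto simp: image_graph_def)
    with step(3) show ?case by simp
  qed simp
  moreover have "\<forall>a\<in>pverts H. \<forall>b\<in>pverts H. (a, b) \<in> (parcs H)\<^sup>*"
    using H by (simp add: pattern_iff)
  ultimately have conn: "\<forall>s\<in>ran f. \<forall>t\<in>ran f. (s, t) \<in> (parcs (image_graph H f))\<^sup>*"
    by (auto simp: ran)
  have "2 \<le> card (ran f)"
  proof -
    obtain x where "x \<in> pverts H"
      using proper by blast
    then obtain y where "(x, y) \<in> parcs H"
      using H pattern_vertex_arc by metis
    then obtain s t where st: "f x = Some s" "f y = Some t" "s \<noteq> t"
      using frag_homs_arc[OF graph proper f] by metis
    then have "{s, t} \<subseteq> ran f"
      by (auto intro: ranI)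
    moreover have "finite (ran f)"
      using fin by (simp add: ran)
    ultimately have "card {s, t} \<le> card (ran f)"
      by (intro card_mono)
    with st show ?thesis by simp
  qed
  moreover have "card (ran f) \<le> 5"
    using card_image_le[OF fin, of "\<lambda>x. the (f x)"] H by (simp add: ran pattern_iff)
  ultimately show ?thesis
    using graph_Q conn by (simp add: pattern_iff) (simp add: image_graph_def)
qed

text \<open>Links failure of injectivity with the size condition in \<open>Shrink\<close>, the range
  having as many elements as the smaller pattern has vertices.\<close>

lemma card_ran_less_iff:
  assumes "finite (dom f)"
  shows "card (ran f) < card (dom f) \<longleftrightarrow> \<not> inj_on f (dom f)"
proof -
  have "card (ran f) = card (dom f) \<longleftrightarrow> inj_on f (dom f)"
    using assms inj_on_iff_eq_card[of "dom f" "\<lambda>x. the (f x)"] by (simp add: the_image_dom inj_map_the_iff)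
  moreover have "card (ran f) \<le> card (dom f)"
    using card_image_le[OF assms, of "\<lambda>x. the (f x)"] by (simp add: the_image_dom)
  ultimately show ?thesis by linarith
qed

text \<open>The match is an isomorphism from the image graph to its representative, read as a
  partial map on the vertices of \<open>G\<close>.\<close>

lemma obtain_factor:
  fixes R :: "nat pair_pre_digraph set"
  assumes H: "pattern H" and proper: "C \<subset> pverts H" and R: "pattern_reps R"
    and f: "f \<in> frag_homs C H G"
  obtains K \<pi> where "K \<in> R" "\<pi> \<in> matches G K" "f \<in> factor C H K \<pi>"
proof -
  have graph: "pair_graph H"
    using H by (rule pattern_graph)
  let ?Q = "image_graph H f"
  have Q: "pattern ?Q"
    using H proper f by (rule pattern_image_graph)
  have vQ: "pverts ?Q = ran f" and aQ: "\<And>s t. (s, t) \<in> parcs ?Q \<longleftrightarrow> (\<exists>a b. (a, b) \<in> parcs H \<and> f a = Some s \<and> f b = Some t)"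
    by (auto simp: image_graph_def)
  obtain K \<gamma> where K: "K \<in> R" and bij: "bij_betw \<gamma> (ran f) (pverts K)"
    and arc: "\<And>x y. x \<in> ran f \<Longrightarrow> y \<in> ran f \<Longrightarrow> (x, y) \<in> parcs ?Q \<longleftrightarrow> (\<gamma> x, \<gamma> y) \<in> parcs K"
    using pattern_reps_obtain[OF R Q] unfolding vQ by metis
  have patK: "pattern K"
    using R K by (simp add: pattern_reps_def)
  have inj: "inj_on \<gamma> (ran f)" and img: "\<gamma> ` ran f = pverts K"
    using bij by (auto simp: bij_betw_def)
  define \<pi> where "\<pi> t = (if t \<in> ran f then Some (\<gamma> t) else None)" for t
  have Some: "\<pi> t = Some x \<longleftrightarrow> t \<in> ran f \<and> x = \<gamma> t" for t x
    by (auto simp: \<pi>_def)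
  have dom: "dom \<pi> = ran f"
    by (auto simp: dom_def Some)
  have \<pi>: "\<pi> \<in> matches G K"
    unfolding matches_iff
  proof (intro conjI allI impI)
    show "dom \<pi> \<subseteq> pverts G"
      using frag_homs_ran[OF graph proper f] by (simp add: dom)
    show "inj_on \<pi> (dom \<pi>)"
      using inj by (auto simp: dom inj_on_def \<pi>_def)
    show "ran \<pi> = pverts K"
      unfolding img[symmetric] by (auto simp: ran_def[of \<pi>] Some)
    fix t u x y assume "\<pi> t = Some x" "\<pi> u = Some y" "(x, y) \<in> parcs K"
    then have "(t, u) \<in> parcs ?Q"
      using arc by (simp add: Some)
    then obtain a b where ab: "(a, b) \<in> parcs H" "f a = Some t" "f b = Some u"
      using aQ by blast
    then show "(t, u) \<in> parcs G"
      using frag_homs_arc[OF graph proper f ab(1)] by (metis option.inject)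
  qed
  \<comment> \<open>The composite is routed through \<open>?Q\<close>, since \<open>\<pi>\<close>
    need not preserve the extra arcs that \<open>G\<close> may have on the range of
    \<open>f\<close>.\<close>
  have "embedding ?Q K \<pi>"
    unfolding embedding_iff
  proof (intro conjI allI impI)
    show "dom \<pi> = pverts ?Q"
      by (simp add: dom vQ)
    show "t \<in> pverts K" if "\<pi> x = Some t" for x t
      using that img by (auto simp: Some)
    show "x = y" if "\<pi> x = Some t" "\<pi> y = Some t" for x y t
      using that inj by (auto simp: Some dest: inj_onD)
    show "(the (\<pi> a), the (\<pi> b)) \<in> parcs K" if ab: "(a, b) \<in> parcs ?Q" for a b
    proof -
      have "a \<in> ran f" "b \<in> ran f"
        using ab by (auto simp: aQ intro: ranI)
      with ab arc show ?thesis by (simp add: \<pi>_def)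
    qed
  qed
  moreover have "f \<in> frag_homs C H ?Q"
  proof -
    have "embedding F ?Q (f |` pverts F)" if F: "F \<in> Frag C H" for F
    proof -
      have emb: "embedding F G (f |` pverts F)"
        using f F by (simp add: frag_homs_def)
      have "(the ((f |` pverts F) a), the ((f |` pverts F) b)) \<in> parcs ?Q" if ab: "(a, b) \<in> parcs F" for a b
      proof -
        have "(a, b) \<in> parcs H" "a \<in> pverts F" "b \<in> pverts F"
          using ab Frag_arcs[OF graph proper F] by auto
        moreover from this obtain s t where "f a = Some s" "f b = Some t"
          using frag_homs_arc[OF graph proper f] by metis
        ultimately show ?thesis
          by (auto simp: aQ)
      qed
      moreover have "ran (f |` pverts F) \<subseteq> ran f"
        by (auto simp: ran_def restrict_map_def)
      ultimately show ?thesis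
        using emb by (auto simp: embedding_def vQ)
    qed
    then show ?thesis
      using f by (simp add: frag_homs_def)
  qed
  ultimately have "\<pi> \<circ>\<^sub>m f \<in> frag_homs C H K"
    using frag_homs_comp[OF graph proper] by blast
  moreover have "\<exists>a b. (a, b) \<in> parcs H \<and> (\<pi> \<circ>\<^sub>m f) a = Some s \<and> (\<pi> \<circ>\<^sub>m f) b = Some t"
    if st: "(s, t) \<in> parcs K" for s t
  proof -
    have "s \<in> \<gamma> ` ran f" "t \<in> \<gamma> ` ran f"
      using st patK unfolding img by (auto simp: pattern_iff pair_graph_iff)
    then obtain x y where xy: "x \<in> ran f" "y \<in> ran f" "s = \<gamma> x" "t = \<gamma> y"
      by auto
    then obtain a b where "(a, b) \<in> parcs H" "f a = Some x" "f b = Some y"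
      using st arc aQ by blast
    with xy have "(a, b) \<in> parcs H \<and> (\<pi> \<circ>\<^sub>m f) a = Some s \<and> (\<pi> \<circ>\<^sub>m f) b = Some t"
      by (simp add: Some)
    then show ?thesis
      by blast
  qed
  ultimately have "\<pi> \<circ>\<^sub>m f \<in> arc_onto C H K"
    by (fastforce simp: arc_onto_def)
  then have "f \<in> factor C H K \<pi>"
    using f by (simp add: factor_def dom frag_homs_def)
  with K \<pi> show ?thesis
    using that by blast
qed

subsection \<open>Counting the non-injective maps\<close>

lemma quotient_mono: "A \<subseteq> B \<Longrightarrow> A // r \<subseteq> B // r"
  by (auto simp: quotient_def)

lemma match_class_factor:
  assumes graph: "pair_graph H" and proper: "C \<subset> pverts H" and K: "parcs K \<subseteq> pverts K \<times> pverts K"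
    and eq: "(\<pi>, \<rho>) \<in> match_equiv G K"
  shows "factor C H K \<pi> = factor C H K \<rho>"
proof -
  have sub: "factor C H K \<pi> \<subseteq> factor C H K \<rho>" if "(\<pi>, \<rho>) \<in> match_equiv G K" for \<pi> \<rho>
    using that factor_automorphism[OF graph proper _ _ K] unfolding match_equiv_def by blast
  have "(\<rho>, \<pi>) \<in> match_equiv G K"
    using equiv_match_equiv eq by (auto elim!: equivE dest: symD)
  with sub eq show ?thesis by blast
qed

definition orbit_matches :: "'a pair_pre_digraph \<Rightarrow> 'a \<Rightarrow> 'b pair_pre_digraph \<times> 'b set \<Rightarrow> ('a \<rightharpoonup> 'b) set" where
  "orbit_matches G v \<theta> = {\<pi> \<in> matches G (fst \<theta>). v \<in> dom \<pi> \<and> the (\<pi> v) \<in> snd \<theta>}"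

lemma DM_eq: "DM G v \<theta> = card (orbit_matches G v \<theta> // match_equiv G (fst \<theta>))"
  by (cases \<theta>) (simp add: orbit_matches_def)

text \<open>An automorphism moves the value at \<open>v\<close> within its orbit, so the orbit
  condition is invariant under equivalence and the classes counted by \<open>DM\<close> are full
  classes of matches.\<close>

lemma orbit_matches_closed:
  assumes "\<theta> \<in> orb K" "\<pi> \<in> orbit_matches G v \<theta>" "(\<pi>, \<rho>) \<in> match_equiv G K"
  shows "\<rho> \<in> orbit_matches G v \<theta>"
proof -
  obtain S where \<theta>: "\<theta> = (K, S)" and S: "S \<in> pverts K // orbit_rel K"
    using assms(1) by (auto simp: orb_def)
  obtain \<alpha> x where \<alpha>: "automorphism K \<alpha>" "\<rho> = map_option \<alpha> \<circ> \<pi>" "\<rho> \<in> matches G K"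
    and x: "\<pi> v = Some x" "x \<in> S"
    using assms(2,3) by (auto simp: \<theta> orbit_matches_def match_equiv_def)
  have "x \<in> pverts K"
    using in_quotient_imp_subset[OF equiv_orbit_rel S] x by blast
  then have "(x, \<alpha> x) \<in> orbit_rel K"
    using \<alpha> automorphism_mem by (auto simp: orbit_rel_def)
  then have "\<alpha> x \<in> S"
    using in_quotient_imp_closed[OF equiv_orbit_rel S] x by blast
  then show ?thesis
    using \<alpha> x by (auto simp: \<theta> orbit_matches_def)
qed

lemma orbit_matches_class:
  assumes "\<theta> \<in> orb K" "c \<in> orbit_matches G v \<theta> // match_equiv G K" "\<pi> \<in> c"
  shows "\<pi> \<in> orbit_matches G v \<theta>" "c \<in> matches G K // match_equiv G K" "\<pi> \<in> matches G K"
proof -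
  have fst: "fst \<theta> = K"
    using assms(1) by (auto simp: orb_def)
  show "\<pi> \<in> orbit_matches G v \<theta>"
    using assms orbit_matches_closed[OF assms(1)] by (auto simp: quotient_def)
  then show "\<pi> \<in> matches G K"
    by (simp add: orbit_matches_def fst)
  show "c \<in> matches G K // match_equiv G K"
    using assms(2) quotient_mono[of "orbit_matches G v \<theta>" "matches G K"]
    by (auto simp: orbit_matches_def fst)
qed

text \<open>The contribution of a single equivalence class \<open>c\<close> of matches to the
  non-injective maps.\<close>

definition class_factor :: "'b set \<Rightarrow> 'b pair_pre_digraph \<Rightarrow> 'b \<Rightarrow> 'a \<Rightarrow> 'c pair_pre_digraph \<Rightarrow>
    ('a \<rightharpoonup> 'c) set \<Rightarrow> ('b \<rightharpoonup> 'a) set" where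
  "class_factor C H i v K c = {f. f i = Some v \<and> (\<exists>\<pi>\<in>c. f \<in> factor C H K \<pi>)}"

text \<open>Equivalent matches admit the same maps, so the union over the class equals the set for
  any one member. A member with value \<open>Min S\<close> at \<open>v\<close> makes it the set
  counted by \<open>numSh\<close>.\<close>

lemma card_class_factor:
  fixes K :: "'c::linorder pair_pre_digraph"
  assumes graph: "pair_graph H" and proper: "C \<subset> pverts H" and i: "i \<in> C" and K: "pair_graph K"
    and \<theta>: "\<theta> \<in> orb K" and c: "c \<in> orbit_matches G v \<theta> // match_equiv G K"
  shows "card (class_factor C H i v K c) = numSh C (H, i) (orbit_rep \<theta>)"
proof -
  have wfK: "parcs K \<subseteq> pverts K \<times> pverts K"
    using K by (simp add: pair_graph_iff)
  obtain S where \<theta>S: "\<theta> = (K, S)" and S: "S \<in> pverts K // orbit_rel K"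
    using \<theta> by (auto simp: orb_def)
  have "finite S" "S \<noteq> {}"
    using in_quotient_imp_subset[OF equiv_orbit_rel S] in_quotient_imp_non_empty[OF equiv_orbit_rel S] K
    by (auto simp: pair_graph_iff intro: finite_subset)
  then have Min: "Min S \<in> S" by simp
  obtain \<pi> where \<pi>: "\<pi> \<in> orbit_matches G v \<theta>" and c\<pi>: "c = match_equiv G K `` {\<pi>}"
    using c by (auto elim: quotientE)
  obtain x where x: "\<pi> v = Some x" "x \<in> S" and m: "\<pi> \<in> matches G K"
    using \<pi> by (auto simp: orbit_matches_def \<theta>S)
  \<comment> \<open>An orbit is one class of \<open>orbit_rel\<close>, so some automorphism carries
    the actual value of the match at \<open>v\<close> to the vertex chosen by
    \<open>orbit_rep\<close>.\<close>
  have "(x, Min S) \<in> orbit_rel K"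
    using in_quotient_imp_in_rel[OF equiv_orbit_rel S] x Min by blast
  then obtain \<alpha> where \<alpha>: "automorphism K \<alpha>" "\<alpha> x = Min S"
    by (auto simp: orbit_rel_def)
  define \<rho> where "\<rho> = map_option \<alpha> \<circ> \<pi>"
  have \<rho>: "\<rho> \<in> matches G K" "\<rho> v = Some (Min S)"
    using matches_automorphism[OF m \<alpha>(1)] x \<alpha> by (simp_all add: \<rho>_def)
  have "(\<pi>, \<rho>) \<in> match_equiv G K"
    using m \<rho> \<alpha> by (auto simp: match_equiv_def \<rho>_def)
  then have \<rho>c: "\<rho> \<in> c"
    by (simp add: c\<pi>)
  moreover have "factor C H K \<sigma> = factor C H K \<rho>" if "\<sigma> \<in> c" for \<sigma>
  proof -
    have "(\<sigma>, \<rho>) \<in> match_equiv G K"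
      using in_quotient_imp_in_rel[OF equiv_match_equiv orbit_matches_class(2)[OF \<theta> c that]] that \<rho>c
      by blast
    then show ?thesis
      by (rule match_class_factor[OF graph proper wfK])
  qed
  ultimately have "class_factor C H i v K c = {f \<in> factor C H K \<rho>. f i = Some v}"
    unfolding class_factor_def by blast
  then have "card (class_factor C H i v K c) = card {g \<in> arc_onto C H K. g i = Some (Min S)}"
    using bij_betw_same_card[OF factor_bij[OF graph proper \<rho>, where i = i]] by simp
  then show ?thesis
    by (simp add: \<theta>S numSh_eq_card[OF graph proper i] del: numSh.simps)
qed

section \<open>Partition of the non-injective maps by pattern, orbit and class\<close>

context
  fixes G :: "'a pair_pre_digraph" and H :: "nat pair_pre_digraph" and C :: "nat set"
    and R :: "nat pair_pre_digraph set" and v :: 'a and i :: nat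
  assumes G: "pair_graph G" and H: "pattern H" and proper: "C \<subset> pverts H" and i: "i \<in> C"
    and R: "pattern_reps R"
begin

text \<open>Flattens the correction term to a single index set: a factor \<open>DM\<close> is
  replaced by the classes that it counts.\<close>

definition shrink_index :: "(nat pair_pre_digraph \<times> (nat pair_pre_digraph \<times> nat set) \<times> ('a \<rightharpoonup> nat) set) set" where
  "shrink_index = (SIGMA K:Shrink R C H. SIGMA \<theta>:orb K. orbit_matches G v \<theta> // match_equiv G K)"

lemma Shrink_pattern:
  assumes "K \<in> Shrink R C H"
  shows "K \<in> R" "pattern K" "pair_graph K" "parcs K \<subseteq> pverts K \<times> pverts K"
proof -
  show "K \<in> R"
    using assms by (simp add: Shrink_def)
  then show "pattern K"
    using R by (simp add: pattern_reps_def)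
  then show "pair_graph K"
    by (rule pattern_graph)
  then show "parcs K \<subseteq> pverts K \<times> pverts K"
    by (simp add: pair_graph_iff)
qed

lemma noninj_eq_UN:
  "{f \<in> frag_homs C H G. f i = Some v \<and> \<not> inj_on f (dom f)} =
     (\<Union>(K, \<theta>, c)\<in>shrink_index. class_factor C H i v K c)"
proof (intro equalityI subsetI)
  have graph: "pair_graph H"
    using H by (rule pattern_graph)
  have fin: "finite (pverts H)"
    using graph by (simp add: pair_graph_iff)
  {
    fix f assume "f \<in> {f \<in> frag_homs C H G. f i = Some v \<and> \<not> inj_on f (dom f)}"
    then have f: "f \<in> frag_homs C H G" "f i = Some v" "\<not> inj_on f (dom f)"
      by auto
    obtain K \<pi> where K: "K \<in> R" and \<pi>: "\<pi> \<in> matches G K" "f \<in> factor C H K \<pi>"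
      using obtain_factor[OF H proper R f(1)] .
    have pK: "pattern K"
      using R K by (simp add: pattern_reps_def)
    have dom: "dom f = pverts H"
      using f(1) by (simp add: frag_homs_def)
    have ran: "ran f = dom \<pi>"
      using factor_ran[OF graph proper \<pi>(2,1) pK] .
    have "card (pverts K) = card (dom \<pi>)"
      using \<pi>(1) bij_betw_same_card[of "\<lambda>t. the (\<pi> t)" "dom \<pi>" "pverts K"] by (simp add: matches_def)
    then have "card (pverts K) < card (pverts H)"
      using card_ran_less_iff[of f] fin dom ran f(3) by simp
    \<comment> \<open>The factorization itself is a witness: \<open>\<pi> \<circ>\<^sub>m f\<close>
      is arc-surjective and splits into a shrinkage.\<close>
    moreover have "shrinkages C H K \<noteq> {}"
      using shrinkages_bij[OF graph proper, of K] \<pi>(2) by (auto simp: bij_betw_def factor_def)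
    ultimately have Sh: "K \<in> Shrink R C H"
      using K by (simp add: Shrink_def)
    have "v \<in> dom \<pi>"
      using ranI[of f i v] f(2) ran by simp
    then obtain x where x: "\<pi> v = Some x" by blast
    then have xK: "x \<in> pverts K"
      using \<pi>(1) by (auto simp: matches_iff intro: ranI)
    \<comment> \<open>The orbit is dictated by where the match sends \<open>v\<close>.\<close>
    define \<theta> where "\<theta> = (K, orbit_rel K `` {x})"
    have \<theta>: "\<theta> \<in> orb K"
      using xK by (auto simp: \<theta>_def orb_def quotientI)
    have "\<pi> \<in> orbit_matches G v \<theta>"
      using \<pi> x equiv_class_self[OF equiv_orbit_rel xK] by (auto simp: \<theta>_def orbit_matches_def)
    then have c: "match_equiv G K `` {\<pi>} \<in> orbit_matches G v \<theta> // match_equiv G K"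
      by (rule quotientI)
    have "\<pi> \<in> match_equiv G K `` {\<pi>}"
      using equiv_class_self[OF equiv_match_equiv \<pi>(1)] .
    then have "f \<in> class_factor C H i v K (match_equiv G K `` {\<pi>})"
      using \<pi> f by (auto simp: class_factor_def)
    with Sh \<theta> c show "f \<in> (\<Union>(K, \<theta>, c)\<in>shrink_index. class_factor C H i v K c)"
      by (auto simp: shrink_index_def intro!: bexI[of _ "(K, \<theta>, match_equiv G K `` {\<pi>})"])
  }
  fix f assume "f \<in> (\<Union>(K, \<theta>, c)\<in>shrink_index. class_factor C H i v K c)"
  then obtain K \<theta> c \<pi> where K: "K \<in> Shrink R C H" and \<theta>: "\<theta> \<in> orb K"
    and c: "c \<in> orbit_matches G v \<theta> // match_equiv G K" "\<pi> \<in> c"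
    and f: "f \<in> factor C H K \<pi>" "f i = Some v"
    by (auto simp: shrink_index_def class_factor_def)
  note pK = Shrink_pattern[OF K]
  have \<pi>: "\<pi> \<in> matches G K"
    using orbit_matches_class[OF \<theta> c] by simp
  have hom: "f \<in> frag_homs C H G"
    using factor_frag_homs[OF graph proper f(1) \<pi> pK(4)] .
  have "card (pverts K) = card (dom \<pi>)"
    using \<pi> bij_betw_same_card[of "\<lambda>t. the (\<pi> t)" "dom \<pi>" "pverts K"] by (simp add: matches_def)
  moreover have "card (pverts K) < card (pverts H)"
    using K by (simp add: Shrink_def)
  moreover have "dom f = pverts H"
    using hom by (simp add: frag_homs_def)
  ultimately have "\<not> inj_on f (dom f)"
    using card_ran_less_iff[of f] fin factor_ran[OF graph proper f(1) \<pi> pK(2)] by simp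
  with hom f show "f \<in> {f \<in> frag_homs C H G. f i = Some v \<and> \<not> inj_on f (dom f)}"
    by simp
qed

text \<open>Two factorizations of \<open>f\<close> give an isomorphism between the patterns, which
  are therefore the same representative. Only then is it an automorphism, which puts the two matches
  in one class and the two values at \<open>v\<close> in one orbit.\<close>

lemma class_factor_disjoint:
  assumes "(K, \<theta>, c) \<in> shrink_index" "(K', \<theta>', c') \<in> shrink_index"
    "f \<in> class_factor C H i v K c" "f \<in> class_factor C H i v K' c'"
  shows "(K, \<theta>, c) = (K', \<theta>', c')"
proof -
  have graph: "pair_graph H"
    using H by (rule pattern_graph)
  have K: "K \<in> Shrink R C H" "K' \<in> Shrink R C H" and \<theta>: "\<theta> \<in> orb K" "\<theta>' \<in> orb K'"
    and c: "c \<in> orbit_matches G v \<theta> // match_equiv G K" "c' \<in> orbit_matches G v \<theta>' // match_equiv G K'"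
    using assms(1,2) by (auto simp: shrink_index_def)
  obtain \<pi> \<pi>' where \<pi>: "\<pi> \<in> c" "f \<in> factor C H K \<pi>" and \<pi>': "\<pi>' \<in> c'" "f \<in> factor C H K' \<pi>'"
    using assms(3,4) by (auto simp: class_factor_def)
  note o = orbit_matches_class[OF \<theta>(1) c(1) \<pi>(1)] and o' = orbit_matches_class[OF \<theta>(2) c(2) \<pi>'(1)]
  note pK = Shrink_pattern[OF K(1)] and pK' = Shrink_pattern[OF K(2)]
  obtain \<alpha> where bij: "bij_betw \<alpha> (pverts K) (pverts K')"
    and arc: "\<forall>x\<in>pverts K. \<forall>y\<in>pverts K. (x, y) \<in> parcs K \<longleftrightarrow> (\<alpha> x, \<alpha> y) \<in> parcs K'"
    and eq: "\<pi>' = map_option \<alpha> \<circ> \<pi>"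
    by (rule factor_unique[OF graph proper \<pi>(2) o(3) pK(2) \<pi>'(2) o'(3) pK'(2)])
  have KK: "K = K'"
    using pattern_reps_unique[OF R pK(1) pK'(1) bij] arc by blast
  have aut: "automorphism K \<alpha>"
    using bij arc KK by (simp add: automorphism_def)
  then have "(\<pi>, \<pi>') \<in> match_equiv G K"
    using o(3) o'(3) KK eq by (auto simp: match_equiv_def)
  then have "c = c'"
    using quotient_eqI[OF equiv_match_equiv o(2) _ \<pi>(1) \<pi>'(1)] o'(2) KK by simp
  moreover have "\<theta> = \<theta>'"
  proof -
    obtain S S' where S: "\<theta> = (K, S)" "S \<in> pverts K // orbit_rel K"
        and S': "\<theta>' = (K, S')" "S' \<in> pverts K // orbit_rel K"
      using \<theta> KK by (auto simp: orb_def)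
    obtain x where x: "\<pi> v = Some x" "x \<in> S"
      using o(1) S by (auto simp: orbit_matches_def)
    have "\<alpha> x \<in> S'"
      using o'(1) S' x eq by (auto simp: orbit_matches_def)
    moreover have "x \<in> pverts K"
      using in_quotient_imp_subset[OF equiv_orbit_rel S(2)] x by blast
    then have "(x, \<alpha> x) \<in> orbit_rel K"
      using aut automorphism_mem by (auto simp: orbit_rel_def)
    ultimately show ?thesis
      using quotient_eqI[OF equiv_orbit_rel S(2) S'(2) x(2)] S S' by simp
  qed
  ultimately show ?thesis
    using KK by simp
qed

lemma card_noninj:
  "card {f \<in> frag_homs C H G. f i = Some v \<and> \<not> inj_on f (dom f)} =
     (\<Sum>K\<in>Shrink R C H. \<Sum>\<theta>\<in>orb K. numSh C (H, i) (orbit_rep \<theta>) * DM G v \<theta>)"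
proof -
  have graph: "pair_graph H"
    using H by (rule pattern_graph)
  have finShrink: "finite (Shrink R C H)"
    using finite_pattern_reps[OF R] by (simp add: Shrink_def)
  have finorb: "finite (orb K)" if "K \<in> Shrink R C H" for K
    using Shrink_pattern(3)[OF that] equiv_orbit_rel[of K] unfolding orb_def pair_graph_iff
    by (auto intro!: finite_quotient elim!: equivE)
  have fincls: "finite (orbit_matches G v \<theta> // match_equiv G K)"
    if "K \<in> Shrink R C H" "\<theta> \<in> orb K" for K \<theta>
  proof -
    have "finite (pverts K)" "finite (pverts G)"
      using Shrink_pattern(3)[OF that(1)] G by (auto simp: pair_graph_iff)
    then have "finite (matches G K)"
      using bij_betw_finite[OF bij_betw_converse_map[OF Shrink_pattern(4)[OF that(1)], of G]]
        finite_embeddings by blast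
    then have "finite (matches G K // match_equiv G K)"
      using equiv_match_equiv by (auto intro!: finite_quotient elim!: equivE)
    moreover have "orbit_matches G v \<theta> \<subseteq> matches G K"
      using that by (auto simp: orbit_matches_def orb_def)
    ultimately show ?thesis
      by (auto intro: finite_subset[OF quotient_mono])
  qed
  have finI: "finite shrink_index"
    unfolding shrink_index_def using finShrink finorb fincls by (intro finite_SigmaI) auto
  have finB: "finite (class_factor C H i v K c)" if "(K, \<theta>, c) \<in> shrink_index" for K \<theta> c
  proof (rule finite_subset)
    show "finite (frag_homs C H G)"
      using finite_frag_homs[OF graph proper, of G] G by (simp add: pair_graph_iff)
    have "class_factor C H i v K c \<subseteq> (\<Union>(K, \<theta>, c)\<in>shrink_index. class_factor C H i v K c)"
      using that by blast
    then show "class_factor C H i v K c \<subseteq> frag_homs C H G"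
      unfolding noninj_eq_UN[symmetric] by blast
  qed
  have "card {f \<in> frag_homs C H G. f i = Some v \<and> \<not> inj_on f (dom f)} =
      (\<Sum>x\<in>shrink_index. card (case x of (K, \<theta>, c) \<Rightarrow> class_factor C H i v K c))"
    unfolding noninj_eq_UN
  proof (rule card_UN_disjoint[OF finI])
    show "\<forall>x\<in>shrink_index. finite (case x of (K, \<theta>, c) \<Rightarrow> class_factor C H i v K c)"
      using finB by auto
    show "\<forall>x\<in>shrink_index. \<forall>y\<in>shrink_index. x \<noteq> y \<longrightarrow>
        (case x of (K, \<theta>, c) \<Rightarrow> class_factor C H i v K c) \<inter>
        (case y of (K, \<theta>, c) \<Rightarrow> class_factor C H i v K c) = {}"
    proof (intro ballI impI)
      fix x y assume xy: "x \<in> shrink_index" "y \<in> shrink_index" "x \<noteq> y"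
      obtain K \<theta> c K' \<theta>' c' where "x = (K, \<theta>, c)" "y = (K', \<theta>', c')"
        by (metis surj_pair)
      with xy class_factor_disjoint[of K \<theta> c K' \<theta>' c'] show
        "(case x of (K, \<theta>, c) \<Rightarrow> class_factor C H i v K c) \<inter>
         (case y of (K, \<theta>, c) \<Rightarrow> class_factor C H i v K c) = {}"
        by auto
    qed
  qed
  also have "\<dots> = (\<Sum>(K, \<theta>, c)\<in>shrink_index. numSh C (H, i) (orbit_rep \<theta>))"
  proof (rule sum.cong[OF refl])
    fix x assume "x \<in> shrink_index"
    then obtain K \<theta> c where "x = (K, \<theta>, c)" "K \<in> Shrink R C H" "\<theta> \<in> orb K"
        "c \<in> orbit_matches G v \<theta> // match_equiv G K"
      by (auto simp: shrink_index_def)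
    then show "card (case x of (K, \<theta>, c) \<Rightarrow> class_factor C H i v K c) =
        (case x of (K, \<theta>, c) \<Rightarrow> numSh C (H, i) (orbit_rep \<theta>))"
      using card_class_factor[OF graph proper i Shrink_pattern(3)] by simp
  qed
  also have "\<dots> = (\<Sum>K\<in>Shrink R C H. \<Sum>\<theta>\<in>orb K.
      \<Sum>c\<in>orbit_matches G v \<theta> // match_equiv G K. numSh C (H, i) (orbit_rep \<theta>))"
  proof -
    have "(\<Sum>\<theta>\<in>orb K. \<Sum>c\<in>orbit_matches G v \<theta> // match_equiv G K. numSh C (H, i) (orbit_rep \<theta>)) =
        (\<Sum>(\<theta>, c)\<in>(SIGMA \<theta>:orb K. orbit_matches G v \<theta> // match_equiv G K). numSh C (H, i) (orbit_rep \<theta>))"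
      if "K \<in> Shrink R C H" for K
      using finorb fincls that by (intro sum.Sigma) auto
    then have "(\<Sum>K\<in>Shrink R C H. \<Sum>\<theta>\<in>orb K.
        \<Sum>c\<in>orbit_matches G v \<theta> // match_equiv G K. numSh C (H, i) (orbit_rep \<theta>)) =
      (\<Sum>K\<in>Shrink R C H.
        \<Sum>(\<theta>, c)\<in>(SIGMA \<theta>:orb K. orbit_matches G v \<theta> // match_equiv G K). numSh C (H, i) (orbit_rep \<theta>))"
      by (rule sum.cong[OF refl])
    also have "\<dots> = (\<Sum>(K, \<theta>, c)\<in>shrink_index. numSh C (H, i) (orbit_rep \<theta>))"
      unfolding shrink_index_def using finShrink finorb fincls
      by (subst sum.Sigma) (auto intro!: finite_SigmaI)
    finally show ?thesis ..
  qed
  \<comment> \<open>The summand does not depend on the class, so the innermost sum is the number of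
    classes times \<open>numSh\<close>.\<close>
  also have "\<dots> = (\<Sum>K\<in>Shrink R C H. \<Sum>\<theta>\<in>orb K. numSh C (H, i) (orbit_rep \<theta>) * DM G v \<theta>)"
  proof (intro sum.cong refl)
    fix K :: "nat pair_pre_digraph" and \<theta>
    assume "\<theta> \<in> orb K"
    then have "fst \<theta> = K" by (auto simp: orb_def)
    then show "(\<Sum>c\<in>orbit_matches G v \<theta> // match_equiv G K. numSh C (H, i) (orbit_rep \<theta>)) =
        numSh C (H, i) (orbit_rep \<theta>) * DM G v \<theta>"
      by (simp add: DM_eq)
  qed
  finally show ?thesis .
qed

end

text \<open>Splits all glued maps with \<open>f i = Some v\<close> into injective and non-injective
  ones. The identity is an addition of cardinalities, passed to integers so that the difference is a
  genuine subtraction.\<close>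

theorem lemma12:
  fixes G :: "'a pair_pre_digraph" and v :: 'a
    and H :: "nat pair_pre_digraph" and S C :: "nat set" and i :: nat
    and R :: "nat pair_pre_digraph set"
  assumes "pair_graph G" and "v \<in> pverts G"
    and "pattern H" and "(H, S) \<in> orb H" and "i \<in> S"
    and "C \<subset> pverts H" and "cut_set H C" and "i \<in> C"
    and "pattern_reps R"
  shows "int (M G v (H, i)) =
     (\<Sum>\<sigma>\<in>matches_at G v (induced H C, i). \<Prod>F\<in>Frag C H. int (deg G F \<sigma>)) -
     (\<Sum>H'\<in>Shrink R C H. \<Sum>\<theta>'\<in>orb H'. int (numSh C (H, i) (orbit_rep \<theta>')) * int (DM G v \<theta>'))"
proof -
  have graph: "pair_graph H"
    using assms(3) by (rule pattern_graph)
  have finG: "finite (pverts G)"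
    using assms(1) by (simp add: pair_graph_iff)
  let ?A = "{f \<in> frag_homs C H G. f i = Some v}"
  let ?I = "{f \<in> frag_homs C H G. f i = Some v \<and> inj_on f (dom f)}"
  let ?N = "{f \<in> frag_homs C H G. f i = Some v \<and> \<not> inj_on f (dom f)}"
  have "finite (frag_homs C H G)"
    using finite_frag_homs[OF graph assms(6) finG] .
  then have "card (?I \<union> ?N) = card ?I + card ?N"
    by (intro card_Un_disjoint) auto
  moreover have "?I \<union> ?N = ?A"
    by blast
  ultimately have "card ?A = card ?I + card ?N"
    by simp
  then have "int (M G v (H, i)) =
      int (\<Sum>\<sigma>\<in>matches_at G v (induced H C, i). \<Prod>F\<in>Frag C H. deg G F \<sigma>) -
      int (\<Sum>H'\<in>Shrink R C H. \<Sum>\<theta>'\<in>orb H'. numSh C (H, i) (orbit_rep \<theta>') * DM G v \<theta>')"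
    unfolding M_eq_card_inj_frag_homs[OF graph assms(6,8)] sum_prod_deg[OF graph assms(6,8) finG]
      card_noninj[OF assms(1,3,6,8,9), symmetric]
    by linarith
  then show ?thesis
    by (simp only: of_nat_sum of_nat_prod of_nat_mult)
qed

end
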